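(* Let $(\Xi^n)_{n\ge 0}$ be generated by an edge iterated graph system satisfying the standing assumptions (canonical, distance-positive, degree-primitive, single-edge initial graph). Let $v\in V(\Xi)$. If $\rho(\mathbf N)>1$, then the local resistance dimension of $\Xi$ at $v$ exists and satisfies $$\dim_{\mathrm{R,loc}}(\Xi:v)=-\frac{\log\rho(\mathbf N)}{\log\rho_{\min}(\mathcal D)}.$$
   Context: **EIGS.** Fix $K\ge1$ colours $[K]=\{1,\dots,K\}$. An edge iterated graph system (EIGS) consists of finite directed rule graphs $R_1,\dots,R_K$ whose edges are coloured by a map $\mathscr C$ with values in $[K]$, each $R_i$ having two distinct planting vertices $\beta_i^+\ne\beta_i^-$, and an initial graph $\Xi^0$, which is a single directed edge of some colour with endpoints $\mathfrak v_+,\mathfrak v_-$. Given $\Xi^n$, the graph $\Xi^{n+1}$ is obtained by simultaneously replacing every directed edge $e=(a,b)$ of colour $i$ by a fresh copy of $R_i$, identifying $a\equiv\beta_i^+$, $b\equiv\beta_i^-$, with no other identifications. Thus $V(\Xi^n)\subset V(\Xi^{n+1})$, and $V(\Xi)=\bigcup_nV(\Xi^n)$. Distances $d_G$, degrees, paths, balls $B_G(v,r)=\{u:d_G(v,u)<r\}$ and resistances refer to underlying undirected graphs, which are assumed simple and connected. **Matrices.** $\mathbf N\in\mathbb N^{2K\times2K}$ has rows $\kappa_{R_1}(\beta_1^+),\kappa_{R_1}(\beta_1^-),\dots,\kappa_{R_K}(\beta_K^+),\kappa_{R_K}(\beta_K^-)$, where $[\kappa_G(v)]_{2j-1}$ (resp.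 $[\kappa_G(v)]_{2j}$) is the number of $j$-coloured edges of $G$ leaving (resp. entering) $v$. $\mathcal D$ is the finite set of $K\times K$ matrices obtained by choosing, for each $i$, a simple path in $R_i$ between $\beta_i^+$ and $\beta_i^-$ and letting the $(i,j)$ entry be the number of $j$-coloured edges on the chosen path. $\rho(\cdot)$ is the spectral radius and $\rho_{\min}(\mathcal D)=\min_{D\in\mathcal D}\rho(D)$. **Standing assumptions.** (1) Canonical: every edge of every $R_i$ lies on a simple path joining $\beta_i^+$ and $\beta_i^-$. (2) Distance-positive: all matrices in $\mathcal D$ have positive entries; if $K=1$, additionally $d_{R_1}(\beta_1^+,\beta_1^-)\ge2$. (3) $\mathbf N$ is primitive. (4) $\Xi^0$ is a single edge. **Local resistance dimension.** For a finite graph $G$, $v\in V(G)$, $A\subseteq V(G)$, $\mathscr R_G(v,A^{\mathrm c})=\bigl(\inf\{\sum_{\{u,w\}\in E(G)}(f(u)-f(w))^2:f(v)=1,\ f\equiv0\text{ on }A^{\mathrm c}\}\bigr)^{-1}$. For a constant $r_*>1$, $$\dim_{\mathrm{R,loc}}(\Xi:v)=\lim_{n\to\infty}\frac{\log\mathscr R_{\Xi^n}\bigl(v,B_{\Xi^n}(v,r_* )^{\mathrm c}\bigr)}{-\log\frac{r_*}{\mathrm{diam}(\Xi^n)}},$$ provided the limit exists and is independent of the choice of $r_*>1$. *)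

theory Defs
  imports
    "Graph_Theory.Graph_Theory"
    "Jordan_Normal_Form.Spectral_Radius"
begin

section \<open>Underlying undirected graphs\<close>

text \<open>
  The underlying undirected graph of a digraph \<open>G\<close> is \<open>mk_symmetric G\<close>, in which an
  undirected edge \<open>{u,w}\<close> is represented by the two pairs \<open>(u,w)\<close> and \<open>(w,u)\<close>.
\<close>

text \<open>
  The locale \<open>digraph\<close> excludes loops and parallel arcs; the second conjunct excludes
  antiparallel arcs, which would also become a double edge of the undirected graph.
\<close>

definition underlying_simple :: "('v, 'e) pre_digraph \<Rightarrow> bool" where
  "underlying_simple G \<longleftrightarrow> digraph G \<and>
     (\<forall>e\<in>arcs G. \<forall>f\<in>arcs G. \<not> (tail G e = head G f \<and> head G e = tail G f))"

text \<open>
  \<open>real_of_ereal\<close> sends infinity to 0, so this is the graph distance only for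
  connected graphs.
\<close>

definition gdist :: "('v, 'e) pre_digraph \<Rightarrow> 'v \<Rightarrow> 'v \<Rightarrow> real" where
  "gdist G u w = real_of_ereal (wf_digraph.\<mu> (with_proj (mk_symmetric G)) (\<lambda>_. 1) u w)"

definition gdiam :: "('v, 'e) pre_digraph \<Rightarrow> real" where
  "gdiam G = Max {gdist G u w | u w. u \<in> verts G \<and> w \<in> verts G}"

definition gball :: "('v, 'e) pre_digraph \<Rightarrow> 'v \<Rightarrow> real \<Rightarrow> 'v set" where
  "gball G v r = {u \<in> verts G. gdist G v u < r}"

definition simple_paths :: "('v, 'e) pre_digraph \<Rightarrow> 'v \<Rightarrow> 'v \<Rightarrow> ('v \<times> 'v) awalk set" where
  "simple_paths G u w = {p. pre_digraph.apath (with_proj (mk_symmetric G)) u p w}"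

definition path_arcs :: "('v, 'e) pre_digraph \<Rightarrow> ('v \<times> 'v) awalk \<Rightarrow> 'e set" where
  "path_arcs G p =
     {e \<in> arcs G. (tail G e, head G e) \<in> set p \<or> (head G e, tail G e) \<in> set p}"


section \<open>Edge iterated graph systems\<close>

text \<open>The \<open>K\<close> colours are \<open>0, \<dots>, K - 1\<close>.\<close>

record ('v, 'e) coloured_digraph =
  dgraph :: "('v, 'e) pre_digraph"
  colour :: "'e \<Rightarrow> nat"

record ('v, 'e) rule_graph = "('v, 'e) coloured_digraph" +
  beta_plus :: 'v
  beta_minus :: 'v

locale eigs =
  fixes K :: nat and R :: "nat \<Rightarrow> ('v, 'e) rule_graph" and c0 :: nat
  assumes K_pos: "K \<ge> 1"
    and initial_colour: "c0 < K"
    and rule_simple: "i < K \<Longrightarrow> underlying_simple (dgraph (R i))"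
    and rule_connected: "i < K \<Longrightarrow> Digraph_Component.connected (dgraph (R i))"
    and rule_colour: "i < K \<Longrightarrow> e \<in> arcs (dgraph (R i)) \<Longrightarrow> colour (R i) e < K"
    and beta_plus_in: "i < K \<Longrightarrow> beta_plus (R i) \<in> verts (dgraph (R i))"
    and beta_minus_in: "i < K \<Longrightarrow> beta_minus (R i) \<in> verts (dgraph (R i))"
    and beta_distinct: "i < K \<Longrightarrow> beta_plus (R i) \<noteq> beta_minus (R i)"

text \<open>
  An arc of the \<open>n\<close>-th graph is the list of length \<open>n\<close> of the rule arcs chosen at the
  successive substitutions, the most recent one first. \<open>Copy e x\<close> is the copy of the
  non-planting rule vertex \<open>x\<close> in the rule graph that replaces the arc \<open>e\<close>. As the
  length of \<open>e\<close> determines the level, \<open>Copy e x\<close> differs from all earlier vertices.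
\<close>

datatype ('v, 'e) iter_vertex = Init_Plus | Init_Minus | Copy "'e list" 'v

type_synonym ('v, 'e) iter_graph = "(('v, 'e) iter_vertex, 'e list) coloured_digraph"

definition initial_graph :: "nat \<Rightarrow> ('v, 'e) iter_graph" where
  "initial_graph c0 =
     \<lparr>dgraph = \<lparr>verts = {Init_Plus, Init_Minus}, arcs = {[]},
                tail = (\<lambda>_. Init_Plus), head = (\<lambda>_. Init_Minus)\<rparr>,
      colour = (\<lambda>_. c0)\<rparr>"

definition place ::
    "(nat \<Rightarrow> ('v, 'e) rule_graph) \<Rightarrow> ('v, 'e) iter_graph \<Rightarrow> 'e list \<Rightarrow> 'v
      \<Rightarrow> ('v, 'e) iter_vertex" where
  "place R G e x =
     (if x = beta_plus (R (colour G e)) then tail (dgraph G) e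
      else if x = beta_minus (R (colour G e)) then head (dgraph G) e
      else Copy e x)"

definition substitute ::
    "(nat \<Rightarrow> ('v, 'e) rule_graph) \<Rightarrow> ('v, 'e) iter_graph \<Rightarrow> ('v, 'e) iter_graph" where
  "substitute R G =
     \<lparr>dgraph =
        \<lparr>verts = verts (dgraph G) \<union>
           {place R G e x | e x. e \<in> arcs (dgraph G) \<and> x \<in> verts (dgraph (R (colour G e)))},
         arcs = {f # e | f e. e \<in> arcs (dgraph G) \<and> f \<in> arcs (dgraph (R (colour G e)))},
         tail = (\<lambda>a. place R G (tl a) (tail (dgraph (R (colour G (tl a)))) (hd a))),
         head = (\<lambda>a. place R G (tl a) (head (dgraph (R (colour G (tl a)))) (hd a)))\<rparr>,
      colour = (\<lambda>a. colour (R (colour G (tl a))) (hd a))\<rparr>"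

primrec Xi :: "(nat \<Rightarrow> ('v, 'e) rule_graph) \<Rightarrow> nat \<Rightarrow> nat \<Rightarrow> ('v, 'e) iter_graph" where
  "Xi R c0 0 = initial_graph c0"
| "Xi R c0 (Suc n) = substitute R (Xi R c0 n)"

definition Xi_verts :: "(nat \<Rightarrow> ('v, 'e) rule_graph) \<Rightarrow> nat \<Rightarrow> ('v, 'e) iter_vertex set" where
  "Xi_verts R c0 = (\<Union>n. verts (dgraph (Xi R c0 n)))"


section \<open>Degree and distance matrices\<close>

text \<open>
  With indices starting at 0, the entries \<open>2 j\<close> and \<open>2 j + 1\<close> of \<open>kappa G v\<close> count the
  \<open>j\<close>-coloured arcs leaving and entering \<open>v\<close>, and the rows \<open>2 i\<close> and \<open>2 i + 1\<close> of
  \<open>degree_matrix\<close> belong to the two planting vertices of the \<open>i\<close>-th rule graph.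
\<close>

definition kappa :: "('v, 'e, 'm) coloured_digraph_scheme \<Rightarrow> 'v \<Rightarrow> nat \<Rightarrow> nat" where
  "kappa G v k =
     card {e \<in> (if even k then out_arcs (dgraph G) v else in_arcs (dgraph G) v).
             colour G e = k div 2}"

definition degree_matrix :: "nat \<Rightarrow> (nat \<Rightarrow> ('v, 'e) rule_graph) \<Rightarrow> nat mat" where
  "degree_matrix K R = mat (2 * K) (2 * K) (\<lambda>(r, c).
     kappa (R (r div 2))
       (if even r then beta_plus (R (r div 2)) else beta_minus (R (r div 2))) c)"

definition distance_matrices :: "nat \<Rightarrow> (nat \<Rightarrow> ('v, 'e) rule_graph) \<Rightarrow> nat mat set" where
  "distance_matrices K R =
     {mat K K (\<lambda>(i, j). card {e \<in> path_arcs (dgraph (R i)) (P i). colour (R i) e = j}) | P.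
        \<forall>i<K. P i \<in> simple_paths (dgraph (R i)) (beta_plus (R i)) (beta_minus (R i))}"

definition rho :: "nat mat \<Rightarrow> real" where
  "rho A = spectral_radius (map_mat of_nat A)"

definition rho_min :: "nat mat set \<Rightarrow> real" where
  "rho_min \<D> = Min (rho ` \<D>)"

definition positive_entries :: "nat mat \<Rightarrow> bool" where
  "positive_entries A \<longleftrightarrow> (\<forall>i<dim_row A. \<forall>j<dim_col A. A $$ (i, j) > 0)"

definition primitive_matrix :: "nat mat \<Rightarrow> bool" where
  "primitive_matrix A \<longleftrightarrow> (\<exists>m>0. positive_entries (A ^\<^sub>m m))"


section \<open>Standing assumptions\<close>

definition canonical :: "nat \<Rightarrow> (nat \<Rightarrow> ('v, 'e) rule_graph) \<Rightarrow> bool" where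
  "canonical K R \<longleftrightarrow> (\<forall>i<K. \<forall>e\<in>arcs (dgraph (R i)).
     \<exists>p\<in>simple_paths (dgraph (R i)) (beta_plus (R i)) (beta_minus (R i)).
       e \<in> path_arcs (dgraph (R i)) p)"

definition distance_positive :: "nat \<Rightarrow> (nat \<Rightarrow> ('v, 'e) rule_graph) \<Rightarrow> bool" where
  "distance_positive K R \<longleftrightarrow>
     (\<forall>D\<in>distance_matrices K R. positive_entries D) \<and>
     (K = 1 \<longrightarrow> gdist (dgraph (R 0)) (beta_plus (R 0)) (beta_minus (R 0)) \<ge> 2)"


section \<open>Local resistance dimension\<close>

text \<open>
  The factor 1/2 compensates that each undirected edge is counted as two pairs.
\<close>

definition energy :: "('v, 'e) pre_digraph \<Rightarrow> ('v \<Rightarrow> real) \<Rightarrow> real" where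
  "energy G f = (\<Sum>(u, w)\<in>parcs (mk_symmetric G). (f u - f w)\<^sup>2) / 2"

text \<open>
  \<open>resistance G v A\<close> is the effective resistance between \<open>v\<close> and the complement of \<open>A\<close>
  in \<open>G\<close>. If \<open>A\<close> contains all vertices of \<open>G\<close>, the infimum is 0 and the infinite
  resistance becomes 0 here. For \<open>A\<close> a ball of fixed radius in graphs whose diameter
  tends to infinity this affects only finitely many terms of the limit below.
\<close>

definition resistance :: "('v, 'e) pre_digraph \<Rightarrow> 'v \<Rightarrow> 'v set \<Rightarrow> real" where
  "resistance G v A =
     inverse (Inf {energy G f | f. f v = 1 \<and> (\<forall>u \<in> verts G - A. f u = 0)})"

text \<open>
  The limit exists and equals \<open>d\<close> for every radius \<open>r > 1\<close>. The finitely many \<open>n\<close> for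
  which \<open>v\<close> is not yet a vertex of \<open>X n\<close> do not matter.
\<close>

definition has_local_resistance_dim ::
    "(nat \<Rightarrow> ('v, 'e) pre_digraph) \<Rightarrow> 'v \<Rightarrow> real \<Rightarrow> bool" where
  "has_local_resistance_dim X v d \<longleftrightarrow>
     (\<forall>r>1. (\<lambda>n. ln (resistance (X n) v (gball (X n) v r)) / (- ln (r / gdiam (X n))))
              \<longlonglongrightarrow> d)"

end

theory Submission
  imports Defs
begin

text \<open>
  Let \<open>u > 0\<close> be the Perron eigenvector of a distance matrix of minimal spectral radius
  \<open>\<lambda>\<close>. Replacing one row of a positive matrix by one that is smaller on \<open>u\<close> would lower
  the spectral radius, so \<open>D u \<ge> \<lambda> u\<close> for every distance matrix \<open>D\<close>. Hence, if edges of
  colour \<open>i\<close> get length \<open>u i\<close>, each substitution scales the distances between old vertices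
  by exactly \<open>\<lambda>\<close>, and the diameter grows like \<open>\<lambda> ^ n\<close>.

  Weighting the edges at \<open>v\<close> with the Perron eigenvector of \<open>\<^bold>N\<close> makes the
  weighted degree of \<open>v\<close> grow by exactly the factor \<open>\<rho>(\<^bold>N)\<close>. The indicator function of \<open>v\<close>
  bounds the conductance by the degree. Conversely, a function that vanishes outside the ball
  vanishes on all vertices other than \<open>v\<close> of the graph a fixed number \<open>m\<close> of levels earlier, and going
  back one level lowers the energy at most by a constant factor, so the conductance is at
  least a constant times the degree of \<open>v\<close> at level \<open>n - m\<close>.
\<close>

section \<open>Perron eigenvectors\<close>

text \<open>Both eigenvector relations are exact, so no error builds up over the levels: the
  logarithms of resistance and diameter are linear in \<open>n\<close> up to bounded terms, and the
  limit is the quotient of the two slopes, whatever the radius.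

  The number \<open>m\<close> of levels can be fixed in advance because distinct vertices of level
  \<open>k\<close> have, at level \<open>k + m\<close>, a distance of at least \<lambda>^m times a
  constant that does not depend on \<open>k\<close>; for large \<open>m\<close> this reaches the
  radius. Here \<lambda> > 1 is essential. It comes from the positive integer entries if there are
  several colours, and from the condition on the planting distance if there is only one.

  The combinatorial obstacle is to keep the iterated graphs simple. Distance-positivity excludes a
  rule arc between the two planting vertices, for the path along that arc alone would give a row
  with at most one nonzero entry. Hence every new arc has an end that is a fresh vertex, and this
  end reveals which old arc was replaced. Energies and degrees then split into sums over the copies
  of the rule graphs.\<close>

lemma rho_eigenpair:
  assumes A: "A \<in> carrier_mat n n" and n: "n > 0"
  obtains w :: "nat \<Rightarrow> complex" and l i where "i < n" "w i \<noteq> 0" "norm l = rho A"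
    "\<And>i. i < n \<Longrightarrow> (\<Sum>j<n. of_nat (A $$ (i, j)) * w j) = l * w i"
proof -
  let ?A = "map_mat of_nat A :: complex mat"
  have cA: "?A \<in> carrier_mat n n" using A by simp
  from spectral_radius_mem_max(1)[OF cA n] obtain l where l: "l \<in> spectrum ?A" "norm l = rho A"
    by (auto simp: rho_def)
  then obtain w where w: "eigenvector ?A w l"
    by (auto simp: spectrum_def eigenvalue_def)
  then have dim: "w \<in> carrier_vec n" and w0: "w \<noteq> 0\<^sub>v n" and eq: "?A *\<^sub>v w = l \<cdot>\<^sub>v w"
    using A by (auto simp: eigenvector_def)
  from dim w0 obtain i where "i < n" "w $ i \<noteq> 0"
    by (metis carrier_vecD eq_vecI index_zero_vec(1) index_zero_vec(2))
  moreover have "(\<Sum>j<n. of_nat (A $$ (i, j)) * w $ j) = l * w $ i" if "i < n" for i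
  proof -
    have "(?A *\<^sub>v w) $ i = (\<Sum>j<n. of_nat (A $$ (i, j)) * w $ j)"
      using that A dim by (auto simp: scalar_prod_def lessThan_atLeast0 intro!: sum.cong)
    with eq that dim show ?thesis by simp
  qed
  ultimately show thesis using that[of i "\<lambda>i. w $ i" l] l by blast
qed

lemma rho_nonneg:
  assumes "A \<in> carrier_mat n n" "n > 0"
  shows "rho A \<ge> 0"
  using rho_eigenpair[OF assms] by (metis norm_ge_zero)

lemma norm_eigenvalue_le_rho:
  assumes A: "A \<in> carrier_mat n n" and ev: "eigenvalue (map_mat of_nat A :: complex mat) l"
  shows "norm l \<le> rho A"
proof -
  have cA: "map_mat of_nat A \<in> carrier_mat n n" using A by simp
  show ?thesis
    unfolding rho_def
    by (rule spectral_radius_mem_max(2)[OF cA eigenvalue_imp_nonzero_dim[OF cA ev]])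
      (use ev in \<open>auto simp: spectrum_def\<close>)
qed

text \<open>Scaling by \<open>1 / t\<close> brings the spectral radius below 1, where the entries of
  all powers are bounded; undoing the scaling gives the rate \<open>t\<close>. At
  \<open>t = rho A\<close> itself, Jordan blocks could add polynomial factors.\<close>

lemma mat_pow_bound:
  assumes A: "A \<in> carrier_mat n n" and n: "n > 0" and t: "rho A < t"
  obtains c where "\<And>k i j. i < n \<Longrightarrow> j < n \<Longrightarrow> real ((A ^\<^sub>m k) $$ (i, j)) \<le> c * t ^ k"
proof -
  let ?A = "map_mat of_nat A :: complex mat"
  let ?B = "complex_of_real (1 / t) \<cdot>\<^sub>m ?A"
  have cA: "?A \<in> carrier_mat n n" and cB: "?B \<in> carrier_mat n n" using A by auto
  have t0: "t > 0" using t rho_nonneg[OF A n] by simp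
  have "spectral_radius ?B < 1"
  proof -
    obtain m where m: "eigenvalue ?B m" "norm m = spectral_radius ?B"
      using spectral_radius_mem_max(1)[OF cB n] by (auto simp: spectrum_def)
    then obtain w where w: "w \<in> carrier_vec n" "w \<noteq> 0\<^sub>v n" "?B *\<^sub>v w = m \<cdot>\<^sub>v w"
      using A by (auto simp: eigenvalue_def eigenvector_def)
    have "?A *\<^sub>v w = of_real t \<cdot>\<^sub>v (?B *\<^sub>v w)"
      using cA w(1) t0 by (intro eq_vecI) (auto simp: scalar_prod_def sum_distrib_left field_simps intro!: sum.cong)
    also have "\<dots> = (of_real t * m) \<cdot>\<^sub>v w"
      unfolding w(3) by (rule smult_smult_assoc)
    finally have "eigenvalue ?A (of_real t * m)"
      using w cA A by (auto simp: eigenvalue_def eigenvector_def)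
    from norm_eigenvalue_le_rho[OF A this] have "t * norm m \<le> rho A"
      using t0 by (simp add: norm_mult)
    with t t0 m show ?thesis by (metis less_le_trans linorder_not_less mult_le_cancel_left1 order.asym)
  qed
  from spectral_radius_jnf_norm_bound_less_1_upper_triangular[OF cB this]
  obtain c where c: "\<And>k. norm_bound (?B ^\<^sub>m k) c" by blast
  have pow: "?B ^\<^sub>m k = complex_of_real ((1 / t) ^ k) \<cdot>\<^sub>m map_mat of_nat (A ^\<^sub>m k)" for k
  proof (induction k)
    case 0
    then show ?case using A by (intro eq_matI) auto
  next
    case (Suc k)
    have Ak: "A ^\<^sub>m k \<in> carrier_mat n n" using A by simp
    have hom: "map_mat of_nat (A ^\<^sub>m k * A) = (map_mat of_nat (A ^\<^sub>m k) * ?A)"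
      by (rule semiring_hom.mat_hom_mult[OF _ Ak A]) (unfold_locales, auto)
    show ?case
      using Ak A unfolding pow_mat.simps Suc hom
      by (intro eq_matI) (auto simp: scalar_prod_def sum_distrib_left field_simps intro!: sum.cong)
  qed
  show thesis
  proof (rule that)
    fix k i j assume ij: "i < n" "j < n"
    have Ak: "A ^\<^sub>m k \<in> carrier_mat n n" using A by simp
    have "norm ((?B ^\<^sub>m k) $$ (i, j)) \<le> c"
      using c[of k] ij carrier_matD[OF pow_carrier_mat[OF cB, of k]]
      unfolding norm_bound_def by metis
    also have "(?B ^\<^sub>m k) $$ (i, j) = complex_of_real ((1 / t) ^ k) * of_nat ((A ^\<^sub>m k) $$ (i, j))"
      unfolding pow using ij carrier_matD[OF Ak] by (simp del: pow_mat_dim)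
    finally show "real ((A ^\<^sub>m k) $$ (i, j)) \<le> c * t ^ k"
      using t0 by (simp add: norm_mult norm_power norm_divide field_simps)
  qed
qed

lemma mat_pow_Suc_sum:
  fixes A :: "nat mat"
  assumes A: "A \<in> carrier_mat n n" and i: "i < n"
  shows "(\<Sum>j<n. real ((A ^\<^sub>m Suc k) $$ (i, j)) * y j) =
    (\<Sum>l<n. real ((A ^\<^sub>m k) $$ (i, l)) * (\<Sum>j<n. real (A $$ (l, j)) * y j))"
proof -
  have Ak: "A ^\<^sub>m k \<in> carrier_mat n n" using A by simp
  have "(\<Sum>j<n. real ((A ^\<^sub>m Suc k) $$ (i, j)) * y j) =
     (\<Sum>j<n. (\<Sum>l<n. real ((A ^\<^sub>m k) $$ (i, l)) * real (A $$ (l, j))) * y j)"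
    using A Ak i by (auto simp: scalar_prod_def lessThan_atLeast0 intro!: sum.cong)
  also have "\<dots> = (\<Sum>j<n. \<Sum>l<n. real ((A ^\<^sub>m k) $$ (i, l)) * real (A $$ (l, j)) * y j)"
    by (simp add: sum_distrib_right)
  also have "\<dots> = (\<Sum>l<n. \<Sum>j<n. real ((A ^\<^sub>m k) $$ (i, l)) * real (A $$ (l, j)) * y j)"
    by (rule sum.swap)
  finally show ?thesis by (simp add: sum_distrib_left mult.assoc)
qed

text \<open>Matrix powers unfold with the new factor on the right. Together with the previous lemma,
  this version with the factor on the left says that \<open>A\<close> commutes with its
  powers.\<close>

lemma mat_pow_Suc_sum':
  fixes A :: "nat mat"
  assumes A: "A \<in> carrier_mat n n" and i: "i < n"
  shows "(\<Sum>j<n. real ((A ^\<^sub>m Suc k) $$ (i, j)) * y j) =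
    (\<Sum>l<n. real (A $$ (i, l)) * (\<Sum>j<n. real ((A ^\<^sub>m k) $$ (l, j)) * y j))"
  using i
proof (induction k arbitrary: i y)
  case 0
  have "(\<Sum>j<n. real ((1\<^sub>m n) $$ (l, j)) * y j) = y l" if "l < n" for l
    using that by (simp add: if_distrib[of real] if_distrib[of "\<lambda>x. x * _"] cong: if_cong)
  then show ?case using A mat_pow_Suc_sum[OF A 0, of 0 y] 0
    by (simp add: if_distrib[of real] if_distrib[of "\<lambda>x. x * _"] cong: if_cong)
next
  case (Suc k)
  show ?case
    unfolding mat_pow_Suc_sum[OF A Suc.prems, of "Suc k"] Suc.IH[OF Suc.prems]
    using mat_pow_Suc_sum[OF A, of _ k y] by (auto intro!: sum.cong)
qed

text \<open>The lower Collatz-Wielandt bound. Iterating the inequality makes the powers of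
  \<open>A\<close> grow on \<open>y\<close> at least like \<open>s ^ k\<close>, whereas for
  \<open>rho A < t < s\<close> their entries are at most of order \<open>t ^ k\<close>.\<close>

lemma le_rho_if_subinvariant:
  assumes A: "A \<in> carrier_mat n n" and n: "n > 0"
    and y: "\<And>i. i < n \<Longrightarrow> y i > 0" and s: "s \<ge> 0"
    and sub: "\<And>i. i < n \<Longrightarrow> s * y i \<le> (\<Sum>j<n. real (A $$ (i, j)) * y j)"
  shows "s \<le> rho A"
proof (rule ccontr)
  assume "\<not> s \<le> rho A"
  then obtain t where t: "rho A < t" "t < s" using dense[of "rho A" s] by auto
  from mat_pow_bound[OF A n t(1)] obtain c
    where c: "\<And>k i j. i < n \<Longrightarrow> j < n \<Longrightarrow> real ((A ^\<^sub>m k) $$ (i, j)) \<le> c * t ^ k" by blast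
  have t0: "t > 0" using t(1) rho_nonneg[OF A n] by simp
  have grow: "s ^ k * y i \<le> (\<Sum>j<n. real ((A ^\<^sub>m k) $$ (i, j)) * y j)" if "i < n" for k i
    using that
  proof (induction k)
    case 0
    have "(\<Sum>j<n. real ((1\<^sub>m n) $$ (i, j)) * y j) = y i"
      using 0 by (simp add: if_distrib[of real] if_distrib[of "\<lambda>x. x * _"] cong: if_cong)
    then show ?case using A by auto
  next
    case (Suc k)
    have "s ^ Suc k * y i \<le> s * (\<Sum>l<n. real ((A ^\<^sub>m k) $$ (i, l)) * y l)"
      using Suc s by (simp add: mult_left_mono mult.assoc)
    also have "\<dots> = (\<Sum>l<n. real ((A ^\<^sub>m k) $$ (i, l)) * (s * y l))"
      by (simp add: sum_distrib_left mult_ac)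
    also have "\<dots> \<le> (\<Sum>l<n. real ((A ^\<^sub>m k) $$ (i, l)) * (\<Sum>j<n. real (A $$ (l, j)) * y j))"
      using sub by (intro sum_mono mult_left_mono) auto
    finally show ?case by (simp only: mat_pow_Suc_sum[OF A Suc.prems])
  qed
  have bound: "(s / t) ^ k * y 0 \<le> c * (\<Sum>j<n. y j)" for k
  proof -
    have "s ^ k * y 0 \<le> (\<Sum>j<n. real ((A ^\<^sub>m k) $$ (0, j)) * y j)" by (rule grow[OF n])
    also have "\<dots> \<le> (\<Sum>j<n. c * t ^ k * y j)"
      using c[OF n] y by (intro sum_mono mult_right_mono) (auto intro: less_imp_le)
    finally show ?thesis using t0
      by (simp add: power_divide field_simps sum_distrib_left)
  qed
  have "1 < s / t" using t t0 by simp
  then obtain k where "c * (\<Sum>j<n. y j) / y 0 < (s / t) ^ k" using real_arch_pow by blast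
  with bound[of k] y[OF n] show False by (simp add: field_simps)
qed

text \<open>The existence part of the Perron-Frobenius theorem. For a complex eigenvector whose
  eigenvalue has modulus \<open>rho A\<close>, the triangle inequality makes the vector
  \<open>z\<close> of moduli satisfy \<open>A z \<ge> rho A z\<close>; primitivity upgrades this to
  equality and then makes \<open>z\<close> positive.\<close>

lemma primitive_eigenvector:
  assumes A: "A \<in> carrier_mat n n" and n: "n > 0" and prim: "primitive_matrix A"
  obtains u where "\<And>i. i < n \<Longrightarrow> u i > 0"
    "\<And>i. i < n \<Longrightarrow> (\<Sum>j<n. real (A $$ (i, j)) * u j) = rho A * u i"
proof -
  obtain m where pos: "positive_entries (A ^\<^sub>m m)" using prim by (auto simp: primitive_matrix_def)
  define P where "P i j = real ((A ^\<^sub>m m) $$ (i, j))" for i j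
  have Am: "A ^\<^sub>m m \<in> carrier_mat n n" using A by simp
  have P: "P i j > 0" if "i < n" "j < n" for i j
    using pos that carrier_matD[OF Am] unfolding positive_entries_def P_def by simp
  obtain w l i0 where i0: "i0 < n" "w i0 \<noteq> 0" and l: "norm l = rho A"
    and w: "\<And>i. i < n \<Longrightarrow> (\<Sum>j<n. complex_of_nat (A $$ (i, j)) * w j) = l * w i"
    using rho_eigenpair[OF A n] by metis
  define z where "z i = norm (w i)" for i
  have z0: "z i \<ge> 0" for i by (simp add: z_def)
  define a where "a z i = (\<Sum>j<n. real (A $$ (i, j)) * z j)" for z i
  have sub: "rho A * z i \<le> a z i" if "i < n" for i
  proof -
    have "rho A * z i = norm (\<Sum>j<n. complex_of_nat (A $$ (i, j)) * w j)"
      using w[OF that] l by (simp add: z_def norm_mult)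
    also have "\<dots> \<le> a z i"
      unfolding a_def z_def by (rule order.trans[OF norm_sum]) (simp add: norm_mult)
    finally show ?thesis .
  qed
  define y where "y i = (\<Sum>j<n. P i j * z j)" for i
  have y: "y i > 0" if "i < n" for i
    unfolding y_def
    by (rule sum_pos2[of _ i0]) (use i0 P that z0 in \<open>auto simp: z_def less_imp_le intro!: mult_nonneg_nonneg\<close>)
  have ay: "a y i = (\<Sum>j<n. P i j * a z j)" if "i < n" for i
    using mat_pow_Suc_sum[OF A that, of m z] mat_pow_Suc_sum'[OF A that, of m z]
    by (simp add: a_def y_def P_def)
  \<comment> \<open>Otherwise \<open>A\<^sup>m\<close> turns \<open>A z \<ge> \<rho> z\<close> into a strict inequality in every component, so some
    \<open>s > \<rho>\<close> satisfies \<open>A y \<ge> s y\<close> with \<open>y = A\<^sup>m z > 0\<close>.\<close>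
  have eq: "a z i = rho A * z i" if "i < n" for i
  proof (rule ccontr)
    assume "a z i \<noteq> rho A * z i"
    with sub[OF that] have strict: "rho A * z i < a z i" by simp
    have gt: "rho A * y k < a y k" if "k < n" for k
    proof -
      have "rho A * y k = (\<Sum>j<n. P k j * (rho A * z j))"
        by (simp add: y_def sum_distrib_left mult_ac)
      also have "\<dots> < (\<Sum>j<n. P k j * a z j)"
        by (rule sum_strict_mono_ex1)
          (use sub P that strict \<open>i < n\<close> in \<open>auto intro!: bexI[of _ i] mult_left_mono intro: less_imp_le\<close>)
      finally show ?thesis using ay that by simp
    qed
    define s where "s = Min ((\<lambda>k. a y k / y k) ` {..<n})"
    have sle: "s * y k \<le> a y k" if "k < n" for k
    proof -
      have "s \<le> a y k / y k" unfolding s_def using that by (intro Min_le) auto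
      then show ?thesis using y[OF that] by (simp add: field_simps)
    qed
    have "s \<in> (\<lambda>k. a y k / y k) ` {..<n}" unfolding s_def using n by (intro Min_in) auto
    then obtain k where "k < n" "s = a y k / y k" by auto
    with gt y have s_gt: "rho A < s" by (simp add: field_simps)
    moreover have "rho A \<ge> 0" using l[symmetric] by simp
    ultimately have "s \<le> rho A"
      by (intro le_rho_if_subinvariant[OF A n y]) (use sle in \<open>auto simp: a_def\<close>)
    with s_gt show False by simp
  qed
  \<comment> \<open>For \<open>k = m\<close> the left-hand side is \<open>y i\<close>, which is
    already known to be positive; so \<open>z i\<close> cannot vanish.\<close>
  have pow: "(\<Sum>j<n. real ((A ^\<^sub>m k) $$ (i, j)) * z j) = rho A ^ k * z i" if "i < n" for i k
    using that
  proof (induction k)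
    case 0
    then show ?case using A
      by (simp add: if_distrib[of real] if_distrib[of "\<lambda>x. x * _"] cong: if_cong)
  next
    case (Suc k)
    have "(\<Sum>l<n. real ((A ^\<^sub>m k) $$ (i, l)) * a z l) = (\<Sum>l<n. real ((A ^\<^sub>m k) $$ (i, l)) * z l) * rho A"
      unfolding sum_distrib_right by (rule sum.cong) (auto simp: eq)
    then show ?case unfolding mat_pow_Suc_sum[OF A Suc.prems] Suc.IH[OF Suc.prems]
      by (simp add: a_def)
  qed
  show thesis
  proof (rule that[of z])
    fix i assume i: "i < n"
    have "rho A ^ m * z i > 0" using pow[OF i, of m] y[OF i] by (simp add: y_def P_def)
    then show "z i > 0" using z0[of i] by (metis less_le mult_zero_right)
    show "(\<Sum>j<n. real (A $$ (i, j)) * z j) = rho A * z i" using eq[OF i] by (simp add: a_def)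
  qed
qed

lemma positive_imp_primitive:
  assumes A: "A \<in> carrier_mat n n" and pos: "positive_entries A"
  shows "primitive_matrix A"
proof -
  have "A ^\<^sub>m Suc 0 = A" using A by simp
  with pos show ?thesis unfolding primitive_matrix_def by (intro exI[of _ "Suc 0"]) simp
qed

text \<open>Scale the Perron vector \<open>w\<close> by the largest \<open>t\<close> with
  \<open>t w \<le> u\<close>; the two vectors touch in some component \<open>k\<close>. If
  \<open>c \<le> rho A\<close>, row \<open>k\<close> gives \<open>A (u - t w)\<close> a value at
  most 0 there, so positivity of \<open>A\<close> forces \<open>u = t w\<close>. Then
  \<open>u\<close> is an eigenvector for \<open>rho A\<close>, against the strict inequality in row
  \<open>i0\<close>.\<close>

lemma rho_less_if_superinvariant:
  assumes A: "A \<in> carrier_mat n n" and n: "n > 0" and pos: "positive_entries A"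
    and u: "\<And>i. i < n \<Longrightarrow> u i > 0"
    and super: "\<And>i. i < n \<Longrightarrow> (\<Sum>j<n. real (A $$ (i, j)) * u j) \<le> c * u i"
    and strict: "i0 < n" "(\<Sum>j<n. real (A $$ (i0, j)) * u j) < c * u i0"
  shows "rho A < c"
proof (rule ccontr)
  assume "\<not> rho A < c"
  then have le: "c \<le> rho A" by simp
  obtain w where w: "\<And>i. i < n \<Longrightarrow> w i > 0"
    and eig: "\<And>i. i < n \<Longrightarrow> (\<Sum>j<n. real (A $$ (i, j)) * w j) = rho A * w i"
    using primitive_eigenvector[OF A n positive_imp_primitive[OF A pos]] by metis
  define t where "t = Min ((\<lambda>k. u k / w k) ` {..<n})"
  have t_le: "t * w k \<le> u k" if "k < n" for k
  proof -
    have "t \<le> u k / w k" unfolding t_def using that by (intro Min_le) auto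
    then show ?thesis using w[OF that] by (simp add: field_simps)
  qed
  have "t \<in> (\<lambda>k. u k / w k) ` {..<n}" unfolding t_def using n by (intro Min_in) auto
  then obtain k where k: "k < n" "u k = t * w k" using w by force
  have "(\<Sum>j<n. real (A $$ (k, j)) * (u j - t * w j)) =
    (\<Sum>j<n. real (A $$ (k, j)) * u j) - t * (\<Sum>j<n. real (A $$ (k, j)) * w j)"
    by (simp add: algebra_simps sum_subtractf sum_distrib_left)
  also have "\<dots> \<le> c * u k - t * (rho A * w k)" using super[OF k(1)] eig[OF k(1)] by simp
  also have "\<dots> \<le> 0" using k le u[OF k(1)] mult_right_mono[OF le, of "u k"] by (simp add: mult_ac)
  finally have le0: "(\<Sum>j<n. real (A $$ (k, j)) * (u j - t * w j)) \<le> 0" .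
  have "u j = t * w j" if "j < n" for j
  proof (rule ccontr)
    assume "u j \<noteq> t * w j"
    with t_le[OF that] have "u j - t * w j > 0" by simp
    then have "0 < (\<Sum>j<n. real (A $$ (k, j)) * (u j - t * w j))"
      by (intro sum_pos2[of _ j])
        (use pos A k that t_le in \<open>auto simp: positive_entries_def intro!: mult_nonneg_nonneg\<close>)
    with le0 show False by simp
  qed
  then have "(\<Sum>j<n. real (A $$ (i0, j)) * u j) = t * (\<Sum>j<n. real (A $$ (i0, j)) * w j)"
    by (simp add: sum_distrib_left mult_ac)
  also have "\<dots> = rho A * u i0" using eig strict(1) \<open>\<And>j. j < n \<Longrightarrow> u j = t * w j\<close> by simp
  finally show False using strict le u[OF strict(1)] by (simp add: mult_right_mono leD)
qed

section \<open>Weighted walks and Lipschitz functions\<close>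

text \<open>Walks that ignore orientation, with the total length as an index instead of a list of
  arcs. Existence of a walk of given length is all that is needed, and such walks can be
  concatenated and mapped without any list bookkeeping.\<close>

inductive uwalk :: "('v, 'e) pre_digraph \<Rightarrow> ('e \<Rightarrow> real) \<Rightarrow> 'v \<Rightarrow> 'v \<Rightarrow> real \<Rightarrow> bool"
  for G w where
  Nil: "x \<in> verts G \<Longrightarrow> uwalk G w x x 0"
| Out: "e \<in> arcs G \<Longrightarrow> uwalk G w (head G e) y s \<Longrightarrow> uwalk G w (tail G e) y (w e + s)"
| In: "e \<in> arcs G \<Longrightarrow> uwalk G w (tail G e) y s \<Longrightarrow> uwalk G w (head G e) y (w e + s)"

lemma uwalk_trans:
  assumes "uwalk G w x y s" "uwalk G w y z t"
  shows "uwalk G w x z (s + t)"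
  using assms by (induction) (auto simp: add.assoc intro: uwalk.intros)

lemma uwalk_arc:
  assumes "wf_digraph G" "e \<in> arcs G"
  shows "uwalk G w (tail G e) (head G e) (w e)" "uwalk G w (head G e) (tail G e) (w e)"
  using uwalk.Out[OF assms(2) uwalk.Nil] uwalk.In[OF assms(2) uwalk.Nil] assms
  by (auto simp: wf_digraph_def)

lemma uwalk_sym:
  assumes "uwalk G w x y s" "wf_digraph G"
  shows "uwalk G w y x s"
  using assms
proof (induction)
  case (Out e y s)
  from uwalk_trans[OF Out.IH[OF Out.prems] uwalk_arc(2)[OF Out.prems Out.hyps(1)]]
  show ?case by (simp add: add.commute)
next
  case (In e y s)
  from uwalk_trans[OF In.IH[OF In.prems] uwalk_arc(1)[OF In.prems In.hyps(1)]]
  show ?case by (simp add: add.commute)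
qed (auto intro: uwalk.intros)

text \<open>Arcs may be sent to whole walks. With \<open>c = 1\<close> this embeds a rule graph as a
  copy; with \<open>c\<close> the scaling factor of distances it replaces each arc by a geodesic of
  its rule graph.\<close>

lemma uwalk_map:
  assumes "uwalk G w x y s" "wf_digraph H"
    and verts: "\<And>z. z \<in> verts G \<Longrightarrow> \<phi> z \<in> verts H"
    and arcs: "\<And>e. e \<in> arcs G \<Longrightarrow> uwalk H w' (\<phi> (tail G e)) (\<phi> (head G e)) (c * w e)"
  shows "uwalk H w' (\<phi> x) (\<phi> y) (c * s)"
  using assms(1)
proof (induction)
  case (Out e y s)
  from uwalk_trans[OF arcs[OF Out.hyps(1)] Out.IH] show ?case by (simp add: algebra_simps)
next
  case (In e y s)
  from uwalk_trans[OF uwalk_sym[OF arcs[OF In.hyps(1)] assms(2)] In.IH]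
  show ?case by (simp add: algebra_simps)
qed (use verts in \<open>auto intro: uwalk.intros\<close>)

lemma uwalk_lipschitz:
  assumes "uwalk G w x y s"
    and "\<And>e. e \<in> arcs G \<Longrightarrow> \<bar>g (tail G e) - g (head G e)\<bar> \<le> C * w e"
  shows "\<bar>g x - g y\<bar> \<le> C * s"
  using assms(1)
proof (induction)
  case (Out e y s)
  with assms(2)[OF Out.hyps(1)] show ?case by (simp add: algebra_simps)
next
  case (In e y s)
  with assms(2)[OF In.hyps(1)] show ?case by (simp add: algebra_simps)
qed auto

lemma uwalk_nonneg:
  assumes "uwalk G w x y s" "\<And>e. e \<in> arcs G \<Longrightarrow> 0 \<le> w e"
  shows "0 \<le> s"
  using assms by (induction) auto

section \<open>Comparison of weighted walks with the graph distance\<close>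

lemma awalk_mk_symmetric_simps:
  "pre_digraph.awalk (with_proj (mk_symmetric G)) x [] y \<longleftrightarrow> x = y \<and> x \<in> verts G"
  "wf_digraph G \<Longrightarrow> pre_digraph.awalk (with_proj (mk_symmetric G)) x (a # p) y \<longleftrightarrow>
     a \<in> parcs (mk_symmetric G) \<and> x = fst a \<and>
     pre_digraph.awalk (with_proj (mk_symmetric G)) (snd a) p y"
  by (auto simp: pre_digraph.awalk_def pre_digraph.cas.simps parcs_mk_symmetric wf_digraph_def)

lemma wf_mk_symmetric: "wf_digraph G \<Longrightarrow> wf_digraph (with_proj (mk_symmetric G))"
  by unfold_locales (auto simp: parcs_mk_symmetric wf_digraph_def)

lemma awalk_imp_uwalk:
  assumes "wf_digraph G" "pre_digraph.awalk (with_proj (mk_symmetric G)) x p y"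
  shows "\<exists>s. uwalk G w x y s"
  using assms(2)
proof (induction p arbitrary: x)
  case Nil
  then show ?case by (auto simp: awalk_mk_symmetric_simps intro: uwalk.intros)
next
  case (Cons a p)
  then obtain s where a: "a \<in> parcs (mk_symmetric G)" "x = fst a" "uwalk G w (snd a) y s"
    by (auto simp: awalk_mk_symmetric_simps(2)[OF assms(1)])
  then obtain e where "e \<in> arcs G" "a = (tail G e, head G e) \<or> a = (head G e, tail G e)"
    by (auto simp: parcs_mk_symmetric)
  with a(2,3) show ?case by (metis uwalk.Out uwalk.In fst_conv snd_conv)
qed

lemma awalk_lipschitz:
  assumes "wf_digraph G" "pre_digraph.awalk (with_proj (mk_symmetric G)) x p y"
    and "\<And>e. e \<in> arcs G \<Longrightarrow> \<bar>g (tail G e) - g (head G e)\<bar> \<le> C"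
  shows "\<bar>g x - g y\<bar> \<le> C * real (length p)"
  using assms(2)
proof (induction p arbitrary: x)
  case Nil
  then show ?case by (auto simp: awalk_mk_symmetric_simps)
next
  case (Cons a p)
  then have a: "a \<in> parcs (mk_symmetric G)" "x = fst a" "\<bar>g (snd a) - g y\<bar> \<le> C * real (length p)"
    by (auto simp: awalk_mk_symmetric_simps(2)[OF assms(1)])
  from a(1) obtain e where "e \<in> arcs G"
    "a = (tail G e, head G e) \<or> a = (head G e, tail G e)" by (auto simp: parcs_mk_symmetric)
  with assms(3)[of e] have "\<bar>g (fst a) - g (snd a)\<bar> \<le> C" by auto
  with a show ?case by (simp add: algebra_simps)
qed

lemma connected_imp_uwalk:
  assumes "wf_digraph G" "Digraph_Component.connected G" "x \<in> verts G" "y \<in> verts G"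
  shows "\<exists>s. uwalk G w x y s"
proof -
  have "x \<rightarrow>\<^sup>*\<^bsub>with_proj (mk_symmetric G)\<^esub> y"
    using assms by (auto simp: connected_def strongly_connected_def)
  then show ?thesis
    using awalk_imp_uwalk[OF assms(1)] wf_digraph.reachable_awalk[OF wf_mk_symmetric[OF assms(1)]]
    by blast
qed

lemma awalk_cost_unit: "wf_digraph G \<Longrightarrow> wf_digraph.awalk_cost (\<lambda>_. 1) p = real (length p)"
  for G :: "('v, 'e) pre_digraph" and p :: "'e list"
  by (simp add: wf_digraph.awalk_cost_def sum_list_triv)

lemma mu_unit_nonneg: "0 \<le> wf_digraph.\<mu> (with_proj (mk_symmetric G)) (\<lambda>_. 1) x y" if "wf_digraph G"
  unfolding wf_digraph.\<mu>_def[OF wf_mk_symmetric[OF that]]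
  by (auto intro!: INF_greatest simp: awalk_cost_unit[OF wf_mk_symmetric[OF that]])

text \<open>The bound is quantified over \<open>c\<close> inside the existential, so the walk is
  also available where no lower bound for the weights is at hand.\<close>

lemma uwalk_imp_awalk:
  assumes wf: "wf_digraph G" and uw: "uwalk G w x y s"
  shows "\<exists>p. pre_digraph.awalk (with_proj (mk_symmetric G)) x p y \<and>
    (\<forall>c. (\<forall>e\<in>arcs G. c \<le> w e) \<longrightarrow> c * real (length p) \<le> s)"
  using uw
proof (induction)
  case (Nil x)
  then show ?case by (auto intro!: exI[of _ "[]"] simp: awalk_mk_symmetric_simps)
next
  case (Out e y s)
  then obtain p where "pre_digraph.awalk (with_proj (mk_symmetric G)) (head G e) p y"
    "\<forall>c. (\<forall>e\<in>arcs G. c \<le> w e) \<longrightarrow> c * real (length p) \<le> s" by blast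
  moreover have "(tail G e, head G e) \<in> parcs (mk_symmetric G)"
    using Out.hyps(1) by (auto simp: parcs_mk_symmetric)
  ultimately show ?case
    using Out.hyps(1)
    by (intro exI[of _ "(tail G e, head G e) # p"])
      (simp add: awalk_mk_symmetric_simps(2)[OF wf] distrib_left add_mono)
next
  case (In e y s)
  then obtain p where "pre_digraph.awalk (with_proj (mk_symmetric G)) (tail G e) p y"
    "\<forall>c. (\<forall>e\<in>arcs G. c \<le> w e) \<longrightarrow> c * real (length p) \<le> s" by blast
  moreover have "(head G e, tail G e) \<in> parcs (mk_symmetric G)"
    using In.hyps(1) by (auto simp: parcs_mk_symmetric)
  ultimately show ?case
    using In.hyps(1)
    by (intro exI[of _ "(head G e, tail G e) # p"])
      (simp add: awalk_mk_symmetric_simps(2)[OF wf] distrib_left add_mono)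
qed

lemma gdist_le_uwalk:
  assumes wf: "wf_digraph G" and uw: "uwalk G w x y s" and c: "c > 0"
    and w: "\<And>e. e \<in> arcs G \<Longrightarrow> c \<le> w e"
  shows "c * gdist G x y \<le> s"
proof -
  obtain p where p: "pre_digraph.awalk (with_proj (mk_symmetric G)) x p y"
    "c * real (length p) \<le> s" using uwalk_imp_awalk[OF wf uw] w by blast
  have "wf_digraph.\<mu> (with_proj (mk_symmetric G)) (\<lambda>_. 1) x y \<le> ereal (real (length p))"
    using wf_digraph.min_cost_le_walk_cost[OF wf_mk_symmetric[OF wf] p(1), of "\<lambda>_. 1"]
    by (simp add: awalk_cost_unit[OF wf_mk_symmetric[OF wf]])
  then have "gdist G x y \<le> real (length p)"
    using real_of_ereal_positive_mono[OF mu_unit_nonneg[OF wf]] unfolding gdist_def by fastforce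
  with p(2) c show ?thesis
    by (meson less_imp_le mult_left_mono order.trans)
qed

text \<open>The walk \<open>uw\<close> guarantees a finite distance. Between unconnected vertices
  \<open>gdist\<close> has the default value 0, and the bound could fail.\<close>

lemma gdist_lipschitz:
  assumes wf: "wf_digraph G" and uw: "uwalk G w x y s" and C: "C > 0"
    and g: "\<And>e. e \<in> arcs G \<Longrightarrow> \<bar>g (tail G e) - g (head G e)\<bar> \<le> C"
  shows "\<bar>g x - g y\<bar> \<le> C * gdist G x y"
proof -
  let ?m = "wf_digraph.\<mu> (with_proj (mk_symmetric G)) (\<lambda>_. 1) x y"
  note m = wf_digraph.\<mu>_def[OF wf_mk_symmetric[OF wf]]
  have lb: "ereal (\<bar>g x - g y\<bar> / C) \<le> ?m"
    unfolding m
  proof (rule INF_greatest)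
    fix p assume "p \<in> {p. pre_digraph.awalk (with_proj (mk_symmetric G)) x p y}"
    then have "\<bar>g x - g y\<bar> \<le> C * real (length p)" using awalk_lipschitz[OF wf _ g] by auto
    then show "ereal (\<bar>g x - g y\<bar> / C) \<le> ereal (wf_digraph.awalk_cost (\<lambda>_. 1) p)"
      using C by (simp add: awalk_cost_unit[OF wf_mk_symmetric[OF wf]] field_simps)
  qed
  obtain p where p: "pre_digraph.awalk (with_proj (mk_symmetric G)) x p y"
    using uwalk_imp_awalk[OF wf uw] by blast
  have "?m \<le> ereal (real (length p))"
    using wf_digraph.min_cost_le_walk_cost[OF wf_mk_symmetric[OF wf] p(1), of "\<lambda>_. 1"]
    by (simp add: awalk_cost_unit[OF wf_mk_symmetric[OF wf]])
  then have "?m \<noteq> \<infinity>" by auto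
  from real_of_ereal_positive_mono[OF _ lb this]
  have "\<bar>g x - g y\<bar> / C \<le> gdist G x y" using C by (simp add: gdist_def)
  then show ?thesis using C by (simp add: field_simps)
qed

section \<open>Simple paths and their sets of arcs\<close>

lemma underlying_simpleD:
  assumes "underlying_simple G"
  shows "wf_digraph G" "finite (verts G)" "finite (arcs G)"
    "\<And>e. e \<in> arcs G \<Longrightarrow> tail G e \<noteq> head G e"
    "\<And>e f. e \<in> arcs G \<Longrightarrow> f \<in> arcs G \<Longrightarrow> tail G e = tail G f \<Longrightarrow> head G e = head G f \<Longrightarrow> e = f"
    "\<And>e f. e \<in> arcs G \<Longrightarrow> f \<in> arcs G \<Longrightarrow> tail G e = head G f \<Longrightarrow> head G e \<noteq> tail G f"
proof -
  from assms interpret digraph G by (simp add: underlying_simple_def)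
  show "wf_digraph G" "finite (verts G)" "finite (arcs G)"
    "\<And>e. e \<in> arcs G \<Longrightarrow> tail G e \<noteq> head G e"
    "\<And>e f. e \<in> arcs G \<Longrightarrow> f \<in> arcs G \<Longrightarrow> tail G e = tail G f \<Longrightarrow> head G e = head G f \<Longrightarrow> e = f"
    by (auto intro: no_multi_arcs simp: no_loops arc_to_ends_def wf_digraph)
  show "\<And>e f. e \<in> arcs G \<Longrightarrow> f \<in> arcs G \<Longrightarrow> tail G e = head G f \<Longrightarrow> head G e \<noteq> tail G f"
    using assms by (auto simp: underlying_simple_def)
qed

lemma underlying_simpleI:
  assumes "wf_digraph G" "finite (verts G)" "finite (arcs G)"
    "\<And>e. e \<in> arcs G \<Longrightarrow> tail G e \<noteq> head G e"
    "\<And>e f. e \<in> arcs G \<Longrightarrow> f \<in> arcs G \<Longrightarrow> tail G e = tail G f \<Longrightarrow> head G e = head G f \<Longrightarrow> e = f"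
    "\<And>e f. e \<in> arcs G \<Longrightarrow> f \<in> arcs G \<Longrightarrow> tail G e = head G f \<Longrightarrow> head G e \<noteq> tail G f"
  shows "underlying_simple G"
proof -
  interpret wf_digraph G by fact
  have "digraph G" by unfold_locales (use assms in \<open>auto simp: arc_to_ends_def\<close>)
  then show ?thesis using assms(6) by (auto simp: underlying_simple_def)
qed

text \<open>In a simple graph a pair of adjacent vertices determines its arc; otherwise one step of
  a path could contribute several arcs.\<close>

lemma path_arcs_Cons:
  assumes "underlying_simple G" "e \<in> arcs G" "a = (tail G e, head G e) \<or> a = (head G e, tail G e)"
  shows "path_arcs G (a # p) = insert e (path_arcs G p)"
  using assms(2,3) underlying_simpleD(5,6)[OF assms(1)] by (auto simp: path_arcs_def)

text \<open>As the weights are nonnegative, counting each arc only once does not raise the total,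
  and neither does cutting out cycles, which merely shrinks the set of arcs.\<close>

lemma uwalk_imp_simple_path:
  assumes G: "underlying_simple G" and uw: "uwalk G w x y s"
    and w: "\<And>e. e \<in> arcs G \<Longrightarrow> 0 \<le> w e"
  shows "\<exists>p\<in>simple_paths G x y. (\<Sum>e\<in>path_arcs G p. w e) \<le> s"
proof -
  note wf = underlying_simpleD(1)[OF G]
  have fin: "finite (path_arcs G p)" for p
    using underlying_simpleD(3)[OF G] by (simp add: path_arcs_def)
  have ins: "(\<Sum>e\<in>insert e (path_arcs G p). w e) \<le> w e + (\<Sum>e\<in>path_arcs G p. w e)"
    if "e \<in> arcs G" for e p
    using fin[of p] w[OF that] by (cases "e \<in> path_arcs G p") (auto simp: insert_absorb)
  have "\<exists>p. pre_digraph.awalk (with_proj (mk_symmetric G)) x p y \<and> (\<Sum>e\<in>path_arcs G p. w e) \<le> s"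
    using uw
  proof (induction)
    case (Nil x)
    then show ?case
      by (auto intro!: exI[of _ "[]"] simp: awalk_mk_symmetric_simps path_arcs_def)
  next
    case (Out e y s)
    then obtain p where p: "pre_digraph.awalk (with_proj (mk_symmetric G)) (head G e) p y"
      "(\<Sum>e\<in>path_arcs G p. w e) \<le> s" by blast
    with Out.hyps(1) ins[OF Out.hyps(1), of p] show ?case
      by (intro exI[of _ "(tail G e, head G e) # p"])
        (auto simp: awalk_mk_symmetric_simps wf parcs_mk_symmetric path_arcs_Cons[OF G Out.hyps(1)])
  next
    case (In e y s)
    then obtain p where p: "pre_digraph.awalk (with_proj (mk_symmetric G)) (tail G e) p y"
      "(\<Sum>e\<in>path_arcs G p. w e) \<le> s" by blast
    with In.hyps(1) ins[OF In.hyps(1), of p] show ?case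
      by (intro exI[of _ "(head G e, tail G e) # p"])
        (auto simp: awalk_mk_symmetric_simps wf parcs_mk_symmetric path_arcs_Cons[OF G In.hyps(1)])
  qed
  then obtain p where p: "pre_digraph.awalk (with_proj (mk_symmetric G)) x p y"
    "(\<Sum>e\<in>path_arcs G p. w e) \<le> s" by blast
  interpret S: wf_digraph "with_proj (mk_symmetric G)" by (rule wf_mk_symmetric[OF wf])
  have "(\<Sum>e\<in>path_arcs G (S.awalk_to_apath p). w e) \<le> (\<Sum>e\<in>path_arcs G p. w e)"
    using S.awalk_to_apath_subset[OF p(1)]
    by (intro sum_mono2 fin) (auto simp: path_arcs_def intro: w)
  with p(2) S.apath_awalk_to_apath[OF p(1)] show ?thesis
    by (auto simp: simple_paths_def intro!: bexI[of _ "S.awalk_to_apath p"])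
qed

lemma simple_path_imp_uwalk:
  assumes G: "underlying_simple G" and p: "p \<in> simple_paths G x y"
  shows "uwalk G w x y (\<Sum>e\<in>path_arcs G p. w e)"
proof -
  note wf = underlying_simpleD(1)[OF G]
  interpret S: wf_digraph "with_proj (mk_symmetric G)" by (rule wf_mk_symmetric[OF wf])
  have "S.apath x p y" using p by (simp add: simple_paths_def)
  then show ?thesis
  proof (induction p arbitrary: x)
    case Nil
    then show ?case by (auto simp: S.apath_Nil_iff path_arcs_def intro: uwalk.intros)
  next
    case (Cons a p)
    then have a: "a \<in> parcs (mk_symmetric G)" "x = fst a" "S.apath (snd a) p y"
      "fst a \<notin> set (S.awalk_verts (snd a) p)"
      by (auto simp: S.apath_Cons_iff)
    from a(1) obtain e where e: "e \<in> arcs G"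
      "a = (tail G e, head G e) \<or> a = (head G e, tail G e)" by (auto simp: parcs_mk_symmetric)
    \<comment> \<open>Both ends of every later step lie on the rest of the path, but
      \<open>fst a\<close> does not. So \<open>e\<close> is not traversed again in either direction,
      and the sum over the set of arcs is the true length.\<close>
    have ends: "fst b \<in> set (S.awalk_verts (snd a) p) \<and> snd b \<in> set (S.awalk_verts (snd a) p)"
      if "b \<in> set p" for b
    proof -
      have "S.awalk (snd a) p y" using a(3) by (simp add: S.apath_def)
      then show ?thesis using that
        by (induction p arbitrary: a) (auto simp: S.awalk_Cons_iff S.hd_in_awalk_verts)
    qed
    have "e \<notin> path_arcs G p" using ends[of "(tail G e, head G e)"] ends[of "(head G e, tail G e)"] a(4) e(2)
      by (auto simp: path_arcs_def)
    moreover have "finite (path_arcs G p)"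
      using underlying_simpleD(3)[OF G] by (simp add: path_arcs_def)
    ultimately have "(\<Sum>e\<in>path_arcs G (a # p). w e) = w e + (\<Sum>e\<in>path_arcs G p. w e)"
      by (simp add: path_arcs_Cons[OF G e])
    then show ?case using Cons.IH[OF a(3)] e a(2) by (auto intro: uwalk.intros)
  qed
qed

lemma finite_simple_paths:
  assumes "underlying_simple G"
  shows "finite (simple_paths G x y)"
proof -
  interpret fin_digraph "with_proj (mk_symmetric G)"
    using underlying_simpleD(1-3)[OF assms] wf_mk_symmetric[of G]
    by (auto intro!: wf_digraph.fin_digraphI simp: parcs_mk_symmetric)
  show ?thesis unfolding simple_paths_def by (rule apaths_finite)
qed

text \<open>Start from the weighted distance \<open>d\<close> to \<open>x\<close>, add it to or
  subtract it from \<open>a\<close>, and truncate at \<open>b\<close>. Truncation preserves the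
  Lipschitz bound, and it is effective at \<open>y\<close> because \<open>d y\<close> is at least
  \<open>L\<close>, hence at least the gap between \<open>a\<close> and \<open>b\<close>.\<close>

lemma lipschitz_interpolation:
  assumes G: "underlying_simple G" and conn: "Digraph_Component.connected G"
    and w: "\<And>e. e \<in> arcs G \<Longrightarrow> 0 \<le> (w e :: real)"
    and xy: "x \<in> verts G" "y \<in> verts G"
    and L: "\<And>p. p \<in> simple_paths G x y \<Longrightarrow> L \<le> (\<Sum>e\<in>path_arcs G p. w e)"
    and ab: "\<bar>a - b\<bar> \<le> L"
  obtains h where "h x = a" "h y = b"
    "\<And>e. e \<in> arcs G \<Longrightarrow> \<bar>h (tail G e) - h (head G e)\<bar> \<le> w e"
proof -
  note wf = underlying_simpleD(1)[OF G]
  define d where "d z = Inf {s. uwalk G w x z s}" for z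
  have bdd: "bdd_below {s. uwalk G w x z s}" for z
    by (rule bdd_belowI[of _ 0]) (auto intro: uwalk_nonneg w)
  have ne: "{s. uwalk G w x z s} \<noteq> {}" if "z \<in> verts G" for z
    using connected_imp_uwalk[OF wf conn xy(1) that] by auto
  have d0: "d z \<ge> 0" if "z \<in> verts G" for z
    unfolding d_def by (rule cInf_greatest[OF ne[OF that]]) (auto intro: uwalk_nonneg w)
  have "d x \<le> 0" unfolding d_def
    by (rule cInf_lower) (use bdd xy in \<open>auto intro: uwalk.intros\<close>)
  with d0[OF xy(1)] have dx: "d x = 0" by simp
  have dy: "L \<le> d y"
    unfolding d_def
  proof (rule cInf_greatest[OF ne[OF xy(2)]])
    fix s assume "s \<in> {s. uwalk G w x y s}"
    then obtain p where "p \<in> simple_paths G x y" "(\<Sum>e\<in>path_arcs G p. w e) \<le> s"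
      using uwalk_imp_simple_path[OF G, of w x y s] w by auto
    with L show "L \<le> s" by force
  qed
  have step: "d z' \<le> d z + c" if "uwalk G w z z' c" "z \<in> verts G" for z z' c
  proof -
    have "d z' - c \<le> d z"
      unfolding d_def[of z]
    proof (rule cInf_greatest[OF ne[OF that(2)]])
      fix s assume "s \<in> {s. uwalk G w x z s}"
      then have "uwalk G w x z' (s + c)" by (auto intro: uwalk_trans[OF _ that(1)])
      then have "d z' \<le> s + c" unfolding d_def by (intro cInf_lower bdd) simp
      then show "d z' - c \<le> s" by simp
    qed
    then show ?thesis by simp
  qed
  have lip: "\<bar>d (tail G e) - d (head G e)\<bar> \<le> w e" if "e \<in> arcs G" for e
    using step[OF uwalk_arc(1)[OF wf that]] step[OF uwalk_arc(2)[OF wf that]] that wf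
    by (auto simp: wf_digraph_def abs_le_iff)
  show thesis
  proof (cases "a \<le> b")
    case True
    show thesis
    proof (rule that[of "\<lambda>z. min b (a + d z)"])
      fix e assume "e \<in> arcs G"
      from lip[OF this] show "\<bar>min b (a + d (tail G e)) - min b (a + d (head G e))\<bar> \<le> w e" by linarith
    qed (use True dx dy ab in auto)
  next
    case False
    show thesis
    proof (rule that[of "\<lambda>z. max b (a - d z)"])
      fix e assume "e \<in> arcs G"
      from lip[OF this] show "\<bar>max b (a - d (tail G e)) - max b (a - d (head G e))\<bar> \<le> w e" by linarith
    qed (use False dx dy ab in auto)
  qed
qed

section \<open>Energy as a sum over arcs\<close>

lemma energy_eq_sum_arcs:
  assumes G: "underlying_simple G"
  shows "energy G f = (\<Sum>e\<in>arcs G. (f (tail G e) - f (head G e))\<^sup>2)"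
proof -
  let ?p = "\<lambda>e. (tail G e, head G e)" and ?q = "\<lambda>e. (head G e, tail G e)"
  note D = underlying_simpleD[OF G]
  have parcs: "parcs (mk_symmetric G) = ?p ` arcs G \<union> ?q ` arcs G"
    by (auto simp: parcs_mk_symmetric)
  have disj: "?p ` arcs G \<inter> ?q ` arcs G = {}" using D(6) by force
  have inj: "inj_on ?p (arcs G)" "inj_on ?q (arcs G)" using D(5) by (auto intro!: inj_onI)
  have "(\<Sum>(u, w)\<in>parcs (mk_symmetric G). (f u - f w)\<^sup>2) =
    (\<Sum>e\<in>arcs G. (f (tail G e) - f (head G e))\<^sup>2) + (\<Sum>e\<in>arcs G. (f (head G e) - f (tail G e))\<^sup>2)"
    unfolding parcs using D(3) disj inj
    by (subst sum.union_disjoint) (auto simp: sum.reindex)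
  then show ?thesis by (simp add: energy_def power2_commute)
qed

text \<open>Each single difference is at most the square root of the energy, so \<open>f\<close> is
  Lipschitz with that constant. The factor \<open>s\<^sup>2\<close> is crude but independent of
  \<open>f\<close>, which is all that matters.\<close>

lemma square_diff_le_energy:
  assumes uw: "uwalk G (\<lambda>_. 1) x y s" and fin: "finite (arcs G)"
  shows "(f x - f y)\<^sup>2 \<le> s\<^sup>2 * (\<Sum>e\<in>arcs G. (f (tail G e) - f (head G e))\<^sup>2)"
proof -
  let ?E = "\<Sum>e\<in>arcs G. (f (tail G e) - f (head G e))\<^sup>2"
  have "\<bar>f x - f y\<bar> \<le> sqrt ?E * s"
  proof (rule uwalk_lipschitz[OF uw])
    fix e assume "e \<in> arcs G"
    then have "(f (tail G e) - f (head G e))\<^sup>2 \<le> ?E"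
      using fin by (intro member_le_sum) auto
    then show "\<bar>f (tail G e) - f (head G e)\<bar> \<le> sqrt ?E * 1"
      by (simp add: real_le_rsqrt flip: real_sqrt_abs)
  qed
  then have "(f x - f y)\<^sup>2 \<le> (sqrt ?E * s)\<^sup>2" by (metis abs_ge_zero power2_abs power_mono)
  also have "\<dots> = s\<^sup>2 * ?E" by (simp add: power_mult_distrib sum_nonneg)
  finally show ?thesis .
qed

section \<open>Substitution\<close>

text \<open>Turns existence statements about the finitely many rule graphs into one constant, which
  then serves at every level.\<close>

lemma finite_uniform_bound:
  fixes P :: "'a \<Rightarrow> 'b \<Rightarrow> real \<Rightarrow> bool"
  assumes "finite I" "\<And>i. i \<in> I \<Longrightarrow> finite (V i)"
    and "\<And>i x. i \<in> I \<Longrightarrow> x \<in> V i \<Longrightarrow> \<exists>s. P i x s"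
  shows "\<exists>C\<ge>0. \<forall>i\<in>I. \<forall>x\<in>V i. \<exists>s. \<bar>s\<bar> \<le> C \<and> P i x s"
proof -
  obtain s where s: "\<And>i x. i \<in> I \<Longrightarrow> x \<in> V i \<Longrightarrow> P i x (s i x)" using assms(3) by metis
  show ?thesis
  proof (intro exI conjI ballI)
    show "0 \<le> (\<Sum>i\<in>I. \<Sum>x\<in>V i. \<bar>s i x\<bar>)" by (intro sum_nonneg) auto
    fix i x assume ix: "i \<in> I" "x \<in> V i"
    have "\<bar>s i x\<bar> \<le> (\<Sum>x\<in>V i. \<bar>s i x\<bar>)"
      using ix assms by (intro member_le_sum) auto
    also have "\<dots> \<le> (\<Sum>i\<in>I. \<Sum>x\<in>V i. \<bar>s i x\<bar>)"
      using ix assms by (intro member_le_sum) (auto intro: sum_nonneg)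
    finally show "\<bar>s i x\<bar> \<le> (\<Sum>i\<in>I. \<Sum>x\<in>V i. \<bar>s i x\<bar>)" .
    show "P i x (s i x)" by (rule s[OF ix])
  qed
qed

lemma substitute_simps [simp]:
  "verts (dgraph (substitute R G)) = verts (dgraph G) \<union>
     {place R G e x | e x. e \<in> arcs (dgraph G) \<and> x \<in> verts (dgraph (R (colour G e)))}"
  "arcs (dgraph (substitute R G)) =
     {f # e | f e. e \<in> arcs (dgraph G) \<and> f \<in> arcs (dgraph (R (colour G e)))}"
  "tail (dgraph (substitute R G)) (f # e) = place R G e (tail (dgraph (R (colour G e))) f)"
  "head (dgraph (substitute R G)) (f # e) = place R G e (head (dgraph (R (colour G e))) f)"
  "colour (substitute R G) (f # e) = colour (R (colour G e)) f"
  by (simp_all add: substitute_def)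

definition weight :: "(nat \<Rightarrow> real) \<Rightarrow> ('v, 'e, 'm) coloured_digraph_scheme \<Rightarrow> 'e \<Rightarrow> real" where
  "weight w G e = w (colour G e)"

text \<open>The scalar product of \<open>kappa G v\<close> with \<open>y\<close>, written as a sum
  over arcs because substitution acts arc by arc.\<close>

definition degree_sum :: "(nat \<Rightarrow> real) \<Rightarrow> ('v, 'e, 'm) coloured_digraph_scheme \<Rightarrow> 'v \<Rightarrow> real" where
  "degree_sum y G v = (\<Sum>e\<in>arcs (dgraph G).
     (if tail (dgraph G) e = v then y (2 * colour G e) else 0) +
     (if head (dgraph G) e = v then y (2 * colour G e + 1) else 0))"

definition lipschitz_weight ::
    "(nat \<Rightarrow> real) \<Rightarrow> ('v, 'e, 'm) coloured_digraph_scheme \<Rightarrow> ('v \<Rightarrow> real) \<Rightarrow> bool" where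
  "lipschitz_weight w G g \<longleftrightarrow> (\<forall>e\<in>arcs (dgraph G).
     \<bar>g (tail (dgraph G) e) - g (head (dgraph G) e)\<bar> \<le> weight w G e)"

text \<open>The form in which distance-positivity is used to keep graphs simple: every rule arc has
  an end that is not a planting vertex, so every new arc has a fresh end.\<close>

locale separated_eigs = eigs K R c0
  for K and R :: "nat \<Rightarrow> ('v, 'e) rule_graph" and c0 +
  assumes planting_not_adjacent:
    "i < K \<Longrightarrow> e \<in> arcs (dgraph (R i)) \<Longrightarrow>
      {tail (dgraph (R i)) e, head (dgraph (R i)) e} \<noteq> {beta_plus (R i), beta_minus (R i)}"
begin

text \<open>The invariant of the iteration. The two conditions on lengths make
  \<open>Copy e x\<close> a new vertex for every arc \<open>e\<close> of \<open>G\<close>: its list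
  has length \<open>n\<close>, while those in existing vertices are shorter.\<close>

definition admissible :: "nat \<Rightarrow> ('v, 'e) iter_graph \<Rightarrow> bool" where
  "admissible n G \<longleftrightarrow> underlying_simple (dgraph G) \<and>
     (\<forall>e\<in>arcs (dgraph G). colour G e < K \<and> length e = n) \<and>
     (\<forall>e x. Copy e x \<in> verts (dgraph G) \<longrightarrow> length e < n)"

lemmas rule_wf = underlying_simpleD(1)[OF rule_simple]
  and rule_finite = underlying_simpleD(2,3)[OF rule_simple]
  and rule_loopfree = underlying_simpleD(4)[OF rule_simple]

lemma rule_ends:
  assumes "i < K" "f \<in> arcs (dgraph (R i))"
  shows "tail (dgraph (R i)) f \<in> verts (dgraph (R i))" "head (dgraph (R i)) f \<in> verts (dgraph (R i))"
  using rule_wf[OF assms(1)] assms(2) by (auto simp: wf_digraph_def)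

lemma rule_arc_inner:
  assumes "i < K" "f \<in> arcs (dgraph (R i))"
  shows "tail (dgraph (R i)) f \<notin> {beta_plus (R i), beta_minus (R i)} \<or>
    head (dgraph (R i)) f \<notin> {beta_plus (R i), beta_minus (R i)}"
  using planting_not_adjacent[OF assms] rule_loopfree[OF assms] by auto

context
  fixes n G
  assumes adm: "admissible n G"
begin

abbreviation rule where "rule e \<equiv> R (colour G e)"

lemma
  shows G_simple: "underlying_simple (dgraph G)"
    and G_colour: "e \<in> arcs (dgraph G) \<Longrightarrow> colour G e < K"
    and G_length: "e \<in> arcs (dgraph G) \<Longrightarrow> length e = n"
    and G_fresh: "e \<in> arcs (dgraph G) \<Longrightarrow> Copy e x \<notin> verts (dgraph G)"
  using adm by (auto simp: admissible_def)

lemma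
  assumes "e \<in> arcs (dgraph G)"
  shows G_tail: "tail (dgraph G) e \<in> verts (dgraph G)"
    and G_head: "head (dgraph G) e \<in> verts (dgraph G)"
    and G_loopfree: "tail (dgraph G) e \<noteq> head (dgraph G) e"
  using underlying_simpleD(1,4)[OF G_simple] assms by (auto simp: wf_digraph_def)

lemma place_planting:
  assumes "e \<in> arcs (dgraph G)"
  shows "place R G e (beta_plus (rule e)) = tail (dgraph G) e"
    "place R G e (beta_minus (rule e)) = head (dgraph G) e"
  using beta_distinct[OF G_colour[OF assms]] by (auto simp: place_def)

lemma place_inner: "x \<notin> {beta_plus (rule e), beta_minus (rule e)} \<Longrightarrow> place R G e x = Copy e x"
  by (auto simp: place_def)

lemma place_cases:
  assumes "e \<in> arcs (dgraph G)"
  obtains "x = beta_plus (rule e)" "place R G e x = tail (dgraph G) e"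
  | "x = beta_minus (rule e)" "place R G e x = head (dgraph G) e"
  | "x \<notin> {beta_plus (rule e), beta_minus (rule e)}" "place R G e x = Copy e x"
  using place_planting[OF assms] place_inner[of x e]
  by (cases "x = beta_plus (rule e)"; cases "x = beta_minus (rule e)") auto

lemma place_eq_old_iff:
  assumes "e \<in> arcs (dgraph G)" "v \<in> verts (dgraph G)"
  shows "place R G e x = v \<longleftrightarrow>
    x = beta_plus (rule e) \<and> tail (dgraph G) e = v \<or> x = beta_minus (rule e) \<and> head (dgraph G) e = v"
  using place_planting[OF assms(1)] G_fresh[OF assms(1), of x] assms(2)
  by (rule_tac x=x in place_cases[OF assms(1)]) auto

text \<open>A fresh vertex stores both the arc it was created for and its rule vertex, and it
  differs from all old vertices.\<close>

lemma place_inner_eq: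
  assumes "e \<in> arcs (dgraph G)" "e' \<in> arcs (dgraph G)"
    and "x \<notin> {beta_plus (rule e), beta_minus (rule e)}" "place R G e x = place R G e' y"
  shows "e' = e" "y = x"
proof -
  have eq: "place R G e' y = Copy e x" using assms(3,4) place_inner by simp
  from G_fresh[OF assms(1), of x] G_tail[OF assms(2)] G_head[OF assms(2)] eq
  have "place R G e' y = Copy e' y" by (cases rule: place_cases[OF assms(2), of y]) auto
  with eq show "e' = e" "y = x" by auto
qed

lemma place_inj:
  assumes e: "e \<in> arcs (dgraph G)" and eq: "place R G e x = place R G e y"
  shows "x = y"
proof (cases "x \<in> {beta_plus (rule e), beta_minus (rule e)} \<and> y \<in> {beta_plus (rule e), beta_minus (rule e)}")
  case True
  then show ?thesis using place_planting[OF e] G_loopfree[OF e] eq by auto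
next
  case False
  then show ?thesis using place_inner_eq(2)[OF e e _ eq] place_inner_eq(2)[OF e e _ eq[symmetric]] by blast
qed

text \<open>One end of \<open>f\<close> is fresh and identifies \<open>e\<close>. As
  \<open>x\<close> and \<open>y\<close> are arbitrary, this covers parallel and antiparallel arcs
  alike.\<close>

lemma place_arc_same:
  assumes e: "e \<in> arcs (dgraph G)" "e' \<in> arcs (dgraph G)"
    and f: "f \<in> arcs (dgraph (rule e))"
    and eq: "place R G e (tail (dgraph (rule e)) f) = place R G e' x"
      "place R G e (head (dgraph (rule e)) f) = place R G e' y"
  shows "e' = e"
  using rule_arc_inner[OF G_colour[OF e(1)] f] place_inner_eq(1)[OF e _ eq(1)] place_inner_eq(1)[OF e _ eq(2)]
  by blast

lemma place_in_verts:
  "e \<in> arcs (dgraph G) \<Longrightarrow> x \<in> verts (dgraph (rule e)) \<Longrightarrow>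
    place R G e x \<in> verts (dgraph (substitute R G))"
  by auto

lemma finite_substitute:
  "finite (verts (dgraph (substitute R G)))" "finite (arcs (dgraph (substitute R G)))"
proof -
  note F = underlying_simpleD(2,3)[OF G_simple]
  have "{place R G e x | e x. e \<in> arcs (dgraph G) \<and> x \<in> verts (dgraph (rule e))} =
    (\<Union>e\<in>arcs (dgraph G). place R G e ` verts (dgraph (rule e)))" by auto
  then show "finite (verts (dgraph (substitute R G)))"
    using F rule_finite G_colour by auto
  have "arcs (dgraph (substitute R G)) = (\<Union>e\<in>arcs (dgraph G). (\<lambda>f. f # e) ` arcs (dgraph (rule e)))"
    by auto
  then show "finite (arcs (dgraph (substitute R G)))"
    using F rule_finite G_colour by auto
qed

lemma wf_substitute: "wf_digraph (dgraph (substitute R G))"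
proof
  fix a assume "a \<in> arcs (dgraph (substitute R G))"
  then obtain e f where a: "a = f # e" "e \<in> arcs (dgraph G)" "f \<in> arcs (dgraph (rule e))" by auto
  from place_in_verts[OF a(2) rule_ends(1)[OF G_colour[OF a(2)] a(3)]]
    place_in_verts[OF a(2) rule_ends(2)[OF G_colour[OF a(2)] a(3)]]
  show "tail (dgraph (substitute R G)) a \<in> verts (dgraph (substitute R G))"
    "head (dgraph (substitute R G)) a \<in> verts (dgraph (substitute R G))"
    unfolding a(1) substitute_simps(3,4) by blast+
qed

lemma admissible_substitute: "admissible (Suc n) (substitute R G)"
  unfolding admissible_def
proof (intro conjI allI impI ballI)
  show "underlying_simple (dgraph (substitute R G))"
  proof (rule underlying_simpleI[OF wf_substitute finite_substitute])
    fix a assume "a \<in> arcs (dgraph (substitute R G))"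
    then obtain e f where a: "a = f # e" "e \<in> arcs (dgraph G)" "f \<in> arcs (dgraph (rule e))" by auto
    show "tail (dgraph (substitute R G)) a \<noteq> head (dgraph (substitute R G)) a"
      using place_inj[OF a(2)] rule_loopfree[OF G_colour[OF a(2)] a(3)] by (auto simp: a(1))
  next
    fix a b assume ab: "a \<in> arcs (dgraph (substitute R G))" "b \<in> arcs (dgraph (substitute R G))"
    from ab(1) obtain e f where a: "a = f # e" "e \<in> arcs (dgraph G)" "f \<in> arcs (dgraph (rule e))" by auto
    from ab(2) obtain e' f' where b: "b = f' # e'" "e' \<in> arcs (dgraph G)" "f' \<in> arcs (dgraph (rule e'))" by auto
    note S = underlying_simpleD[OF rule_simple[OF G_colour[OF a(2)]]]
    {
      assume t: "tail (dgraph (substitute R G)) a = tail (dgraph (substitute R G)) b"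
        and h: "head (dgraph (substitute R G)) a = head (dgraph (substitute R G)) b"
      have [simp]: "e' = e" using place_arc_same[OF a(2) b(2) a(3)] t h by (simp add: a(1) b(1))
      show "a = b" using t h S(5)[OF a(3)] b(3) by (auto simp: a(1) b(1) dest!: place_inj[OF a(2)])
    }
    {
      assume t: "tail (dgraph (substitute R G)) a = head (dgraph (substitute R G)) b"
      show "head (dgraph (substitute R G)) a \<noteq> tail (dgraph (substitute R G)) b"
      proof
        assume h: "head (dgraph (substitute R G)) a = tail (dgraph (substitute R G)) b"
        have [simp]: "e' = e" using place_arc_same[OF a(2) b(2) a(3)] t h by (simp add: a(1) b(1))
        show False using t h S(6)[OF a(3)] b(3) by (auto simp: a(1) b(1) dest!: place_inj[OF a(2)])
      qed
    }
  qed
next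
  fix a assume "a \<in> arcs (dgraph (substitute R G))"
  then obtain e f where a: "a = f # e" "e \<in> arcs (dgraph G)" "f \<in> arcs (dgraph (rule e))" by auto
  show "colour (substitute R G) a < K" using rule_colour[OF G_colour[OF a(2)] a(3)] by (simp add: a(1))
  show "length a = Suc n" using G_length[OF a(2)] by (simp add: a(1))
next
  fix e :: "'e list" and x assume "Copy e x \<in> verts (dgraph (substitute R G))"
  then consider "Copy e x \<in> verts (dgraph G)"
    | e' x' where "Copy e x = place R G e' x'" "e' \<in> arcs (dgraph G)" by auto
  then show "length e < Suc n"
  proof cases
    case 1
    then show ?thesis using adm by (auto simp: admissible_def)
  next
    case 2
    then have "Copy e x \<in> verts (dgraph G) \<or> Copy e x = Copy e' x'"
      using G_tail[OF 2(2)] G_head[OF 2(2)]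
      by (cases rule: place_cases[OF 2(2), of x']) simp_all
    then show ?thesis
      using G_length[OF 2(2)] adm by (auto simp: admissible_def less_Suc_eq)
  qed
qed

lemma sum_arcs_substitute:
  "(\<Sum>a\<in>arcs (dgraph (substitute R G)). F a) =
   (\<Sum>e\<in>arcs (dgraph G). \<Sum>f\<in>arcs (dgraph (rule e)). F (f # e))"
proof -
  have "arcs (dgraph (substitute R G)) =
    (\<lambda>(e, f). f # e) ` (SIGMA e:arcs (dgraph G). arcs (dgraph (rule e)))" by force
  then have "(\<Sum>a\<in>arcs (dgraph (substitute R G)). F a) =
    (\<Sum>(e, f)\<in>(SIGMA e:arcs (dgraph G). arcs (dgraph (rule e))). F (f # e))"
    by (simp add: sum.reindex inj_on_def case_prod_unfold)
  also have "\<dots> = (\<Sum>e\<in>arcs (dgraph G). \<Sum>f\<in>arcs (dgraph (rule e)). F (f # e))"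
    using underlying_simpleD(3)[OF G_simple] rule_finite(2)[OF G_colour]
    by (intro sum.Sigma[symmetric]) auto
  finally show ?thesis .
qed

text \<open>An old vertex \<open>v\<close> belongs to the copy for \<open>e\<close> only as a
  planting vertex, when \<open>e\<close> leaves or enters \<open>v\<close>. Its weighted degree
  inside that copy is a row of the degree matrix applied to \<open>y\<close>, so each incident arc
  contributes exactly \<open>r\<close> times its former share.\<close>

lemma degree_sum_substitute:
  assumes v: "v \<in> verts (dgraph G)"
    and plus: "\<And>i. i < K \<Longrightarrow> degree_sum y (R i) (beta_plus (R i)) = r * y (2 * i)"
    and minus: "\<And>i. i < K \<Longrightarrow> degree_sum y (R i) (beta_minus (R i)) = r * y (2 * i + 1)"
  shows "degree_sum y (substitute R G) v = r * degree_sum y G v"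
  unfolding degree_sum_def[of y G] degree_sum_def[of y "substitute R G"] sum_arcs_substitute
    sum_distrib_left
proof (rule sum.cong[OF refl])
  fix e assume e: "e \<in> arcs (dgraph G)"
  let ?D = "dgraph (rule e)" and ?t = "tail (dgraph G) e = v" and ?h = "head (dgraph G) e = v"
  let ?F = "\<lambda>b f. (if tail ?D f = b then y (2 * colour (rule e) f) else 0) +
    (if head ?D f = b then y (2 * colour (rule e) f + 1) else 0)"
  have "(\<Sum>f\<in>arcs ?D.
     (if tail (dgraph (substitute R G)) (f # e) = v then y (2 * colour (substitute R G) (f # e)) else 0) +
     (if head (dgraph (substitute R G)) (f # e) = v then y (2 * colour (substitute R G) (f # e) + 1) else 0))
     = (\<Sum>f\<in>arcs ?D. (if ?t then ?F (beta_plus (rule e)) f else 0) + (if ?h then ?F (beta_minus (rule e)) f else 0))"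
    using G_loopfree[OF e] beta_distinct[OF G_colour[OF e]]
    by (intro sum.cong[OF refl]) (auto simp: place_eq_old_iff[OF e v])
  also have "\<dots> = (if ?t then degree_sum y (rule e) (beta_plus (rule e)) else 0) +
     (if ?h then degree_sum y (rule e) (beta_minus (rule e)) else 0)"
    by (simp add: sum.distrib degree_sum_def)
  also have "\<dots> = r * ((if ?t then y (2 * colour G e) else 0) + (if ?h then y (2 * colour G e + 1) else 0))"
    by (simp add: plus[OF G_colour[OF e]] minus[OF G_colour[OF e]] algebra_simps)
  finally show "(\<Sum>f\<in>arcs ?D.
     (if tail (dgraph (substitute R G)) (f # e) = v then y (2 * colour (substitute R G) (f # e)) else 0) +
     (if head (dgraph (substitute R G)) (f # e) = v then y (2 * colour (substitute R G) (f # e) + 1) else 0)) = \<dots>" .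
qed

lemma uwalk_copy:
  assumes e: "e \<in> arcs (dgraph G)" and uw: "uwalk (dgraph (rule e)) (weight w (rule e)) x y s"
  shows "uwalk (dgraph (substitute R G)) (weight w (substitute R G)) (place R G e x) (place R G e y) s"
proof -
  have "uwalk (dgraph (substitute R G)) (weight w (substitute R G)) (place R G e x) (place R G e y) (1 * s)"
  proof (rule uwalk_map[OF uw wf_substitute])
    show "z \<in> verts (dgraph (rule e)) \<Longrightarrow> place R G e z \<in> verts (dgraph (substitute R G))" for z
      using place_in_verts[OF e] .
    fix f assume "f \<in> arcs (dgraph (rule e))"
    then have "f # e \<in> arcs (dgraph (substitute R G))" using e by auto
    from uwalk_arc(1)[OF wf_substitute this, of "weight w (substitute R G)"]
    show "uwalk (dgraph (substitute R G)) (weight w (substitute R G))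
      (place R G e (tail (dgraph (rule e)) f)) (place R G e (head (dgraph (rule e)) f)) (1 * weight w (rule e) f)"
      by (simp add: weight_def)
  qed
  then show ?thesis by simp
qed

text \<open>The same \<open>f\<close> is read on both graphs, since old vertices persist. Each old
  difference is controlled by the energy of \<open>f\<close> on the copy replacing the arc, and
  distinct copies share no arcs, so the estimates add up.\<close>

lemma energy_substitute_ge:
  assumes L: "\<And>i f. i < K \<Longrightarrow> (f (beta_plus (R i)) - f (beta_minus (R i)))\<^sup>2 \<le>
      L * (\<Sum>e\<in>arcs (dgraph (R i)). (f (tail (dgraph (R i)) e) - f (head (dgraph (R i)) e))\<^sup>2)"
  shows "energy (dgraph G) f \<le> L * energy (dgraph (substitute R G)) f"
proof -
  have "energy (dgraph G) f = (\<Sum>e\<in>arcs (dgraph G). (f (tail (dgraph G) e) - f (head (dgraph G) e))\<^sup>2)"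
    by (rule energy_eq_sum_arcs[OF G_simple])
  also have "\<dots> \<le> (\<Sum>e\<in>arcs (dgraph G). L * (\<Sum>a\<in>arcs (dgraph (rule e)).
      (f (place R G e (tail (dgraph (rule e)) a)) - f (place R G e (head (dgraph (rule e)) a)))\<^sup>2))"
  proof (rule sum_mono)
    fix e assume e: "e \<in> arcs (dgraph G)"
    show "(f (tail (dgraph G) e) - f (head (dgraph G) e))\<^sup>2 \<le> L * (\<Sum>a\<in>arcs (dgraph (rule e)).
      (f (place R G e (tail (dgraph (rule e)) a)) - f (place R G e (head (dgraph (rule e)) a)))\<^sup>2)"
      using L[OF G_colour[OF e], of "\<lambda>x. f (place R G e x)"] by (simp add: place_planting[OF e])
  qed
  also have "\<dots> = L * energy (dgraph (substitute R G)) f"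
    using admissible_substitute
    by (simp add: energy_eq_sum_arcs admissible_def sum_arcs_substitute sum_distrib_left del: substitute_simps(2))
  finally show ?thesis .
qed

end

end

section \<open>Iteration over all levels\<close>

context separated_eigs
begin

lemma admissible_Xi: "admissible n (Xi R c0 n)"
proof (induction n)
  case 0
  show ?case
    by (auto simp: admissible_def initial_graph_def initial_colour wf_digraph_def intro!: underlying_simpleI)
next
  case (Suc n)
  then show ?case using admissible_substitute by simp
qed

lemma Xi_simple: "underlying_simple (dgraph (Xi R c0 n))"
  using admissible_Xi by (auto simp: admissible_def)

lemmas Xi_wf = underlying_simpleD(1)[OF Xi_simple]

lemma Xi_verts_mono: "n \<le> m \<Longrightarrow> verts (dgraph (Xi R c0 n)) \<subseteq> verts (dgraph (Xi R c0 m))"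
  by (induction m rule: dec_induct) auto

lemma Init_in_Xi: "Init_Plus \<in> verts (dgraph (Xi R c0 n))" "Init_Minus \<in> verts (dgraph (Xi R c0 n))"
  using Xi_verts_mono[of 0 n] by (auto simp: initial_graph_def)

lemma Xi_arc_colour: "e \<in> arcs (dgraph (Xi R c0 n)) \<Longrightarrow> colour (Xi R c0 n) e < K"
  using admissible_Xi by (auto simp: admissible_def)

lemma degree_sum_Xi:
  assumes "v \<in> verts (dgraph (Xi R c0 n))"
    and "\<And>i. i < K \<Longrightarrow> degree_sum y (R i) (beta_plus (R i)) = r * y (2 * i)"
    and "\<And>i. i < K \<Longrightarrow> degree_sum y (R i) (beta_minus (R i)) = r * y (2 * i + 1)"
  shows "degree_sum y (Xi R c0 (n + k)) v = r ^ k * degree_sum y (Xi R c0 n) v"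
proof (induction k)
  case (Suc k)
  have "v \<in> verts (dgraph (Xi R c0 (n + k)))" using assms(1) Xi_verts_mono[of n "n + k"] by auto
  from degree_sum_substitute[OF admissible_Xi this assms(2,3)] Suc show ?case by simp
qed simp

lemma energy_contraction:
  obtains L where "L > 0" "\<And>n k f. energy (dgraph (Xi R c0 n)) f \<le> L ^ k * energy (dgraph (Xi R c0 (n + k))) f"
proof -
  let ?E = "\<lambda>i f. \<Sum>e\<in>arcs (dgraph (R i)). (f (tail (dgraph (R i)) e) - f (head (dgraph (R i)) e))\<^sup>2"
  have "\<exists>s. uwalk (dgraph (R i)) (\<lambda>_. 1) (beta_plus (R i)) (beta_minus (R i)) s" if "i < K" for i
    using connected_imp_uwalk[OF rule_wf rule_connected beta_plus_in beta_minus_in] that by blast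
  then obtain C where C: "C \<ge> 0" "\<And>i. i < K \<Longrightarrow>
      \<exists>s. \<bar>s\<bar> \<le> C \<and> uwalk (dgraph (R i)) (\<lambda>_. 1) (beta_plus (R i)) (beta_minus (R i)) s"
    \<comment> \<open>The unit type is a dummy second index: each rule graph needs only one
      walk.\<close>
    using finite_uniform_bound[of "{..<K}" "\<lambda>_. {()}"
      "\<lambda>i _ s. uwalk (dgraph (R i)) (\<lambda>_. 1) (beta_plus (R i)) (beta_minus (R i)) s"] by auto
  \<comment> \<open>\<open>C\<close> bounds the lengths of walks across the rule graphs; adding 1
    makes \<open>L\<close> positive even if \<open>C = 0\<close>.\<close>
  define L where "L = C\<^sup>2 + 1"
  have L0: "L > 0" by (simp add: L_def add_nonneg_pos)
  have step: "(f (beta_plus (R i)) - f (beta_minus (R i)))\<^sup>2 \<le> L * ?E i f" if i: "i < K" for i f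
  proof -
    obtain s where s: "\<bar>s\<bar> \<le> C" "uwalk (dgraph (R i)) (\<lambda>_. 1) (beta_plus (R i)) (beta_minus (R i)) s"
      using C(2)[OF i] by blast
    have "(f (beta_plus (R i)) - f (beta_minus (R i)))\<^sup>2 \<le> s\<^sup>2 * ?E i f"
      by (rule square_diff_le_energy[OF s(2) rule_finite(2)[OF i]])
    also have "s\<^sup>2 \<le> L" using power_mono[OF s(1), of 2] by (simp add: L_def)
    then have "s\<^sup>2 * ?E i f \<le> L * ?E i f" by (intro mult_right_mono sum_nonneg) auto
    finally show ?thesis .
  qed
  have "energy (dgraph (Xi R c0 n)) f \<le> L ^ k * energy (dgraph (Xi R c0 (n + k))) f" for n k f
  proof (induction k)
    case (Suc k)
    note Suc
    also have "L ^ k * energy (dgraph (Xi R c0 (n + k))) f \<le>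
        L ^ k * (L * energy (dgraph (substitute R (Xi R c0 (n + k)))) f)"
      using energy_substitute_ge[OF admissible_Xi step] L0 by (intro mult_left_mono) auto
    finally show ?case by (simp add: mult_ac)
  qed simp
  with L0 show thesis using that by blast
qed

end

section \<open>Geodesic edge weights\<close>

text \<open>With edge lengths \<open>w\<close>, the planting vertices of rule \<open>i\<close> have
  distance exactly \<open>lam * w i\<close>: one assumption gives the lower bound, the other a path
  attaining it. That such weights come from an eigenvector is irrelevant for the estimates made
  here.\<close>

locale geodesic_eigs = separated_eigs K R c0
  for K and R :: "nat \<Rightarrow> ('v, 'e) rule_graph" and c0 +
  fixes w :: "nat \<Rightarrow> real" and lam :: real
  assumes w_pos: "i < K \<Longrightarrow> w i > 0"
    and lam_gt_1: "lam > 1"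
    and path_weight_ge: "i < K \<Longrightarrow> p \<in> simple_paths (dgraph (R i)) (beta_plus (R i)) (beta_minus (R i)) \<Longrightarrow>
      lam * w i \<le> (\<Sum>e\<in>path_arcs (dgraph (R i)) p. weight w (R i) e)"
    and geodesic: "i < K \<Longrightarrow> \<exists>p\<in>simple_paths (dgraph (R i)) (beta_plus (R i)) (beta_minus (R i)).
      (\<Sum>e\<in>path_arcs (dgraph (R i)) p. weight w (R i) e) = lam * w i"
begin

lemma rule_weight_pos: "i < K \<Longrightarrow> e \<in> arcs (dgraph (R i)) \<Longrightarrow> weight w (R i) e > 0"
  using rule_colour w_pos by (simp add: weight_def)

text \<open>
  Lower bounds for distances come from extending Lipschitz functions: no walk in the
  substituted graph has to be cut into pieces.
\<close>

lemma lipschitz_substitute: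
  assumes adm: "admissible n G" and g: "lipschitz_weight w G g"
  obtains g' where "lipschitz_weight w (substitute R G) g'"
    "\<And>x. x \<in> verts (dgraph G) \<Longrightarrow> g' x = lam * g x"
proof -
  let ?r = "\<lambda>e. R (colour G e)" and ?D = "\<lambda>e. dgraph (R (colour G e))"
  note col = G_colour[OF adm]
  \<comment> \<open>After multiplication by \<open>lam\<close>, the values at the ends of
    \<open>e\<close> differ by at most \<open>lam * w (colour G e)\<close>, which no path across the
    rule graph undercuts. So they can be interpolated inside the copy.\<close>
  have "\<exists>h. h (beta_plus (?r e)) = lam * g (tail (dgraph G) e) \<and>
      h (beta_minus (?r e)) = lam * g (head (dgraph G) e) \<and>
      (\<forall>f\<in>arcs (?D e). \<bar>h (tail (?D e) f) - h (head (?D e) f)\<bar> \<le> weight w (?r e) f)"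
    if e: "e \<in> arcs (dgraph G)" for e
  proof -
    note i = col[OF e]
    have "\<bar>g (tail (dgraph G) e) - g (head (dgraph G) e)\<bar> \<le> w (colour G e)"
      using g e by (auto simp: lipschitz_weight_def weight_def)
    then have "\<bar>lam * g (tail (dgraph G) e) - lam * g (head (dgraph G) e)\<bar> \<le> lam * w (colour G e)"
      using lam_gt_1 by (simp add: abs_mult flip: right_diff_distrib)
    from lipschitz_interpolation[OF rule_simple[OF i] rule_connected[OF i]
        less_imp_le[OF rule_weight_pos[OF i]] beta_plus_in[OF i] beta_minus_in[OF i]
        path_weight_ge[OF i] this]
    show ?thesis by metis
  qed
  then obtain H where H: "\<And>e. e \<in> arcs (dgraph G) \<Longrightarrow> H e (beta_plus (?r e)) = lam * g (tail (dgraph G) e)"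
      "\<And>e. e \<in> arcs (dgraph G) \<Longrightarrow> H e (beta_minus (?r e)) = lam * g (head (dgraph G) e)"
      "\<And>e f. e \<in> arcs (dgraph G) \<Longrightarrow> f \<in> arcs (?D e) \<Longrightarrow>
        \<bar>H e (tail (?D e) f) - H e (head (?D e) f)\<bar> \<le> weight w (?r e) f"
    by metis
  \<comment> \<open>Fresh vertices take the interpolated value of their own copy. The default 0
    concerns only terms that are vertices of neither graph.\<close>
  define g' where "g' z = (if z \<in> verts (dgraph G) then lam * g z
    else case z of Copy e x \<Rightarrow> H e x | _ \<Rightarrow> 0)" for z
  have place: "g' (place R G e x) = H e x" if e: "e \<in> arcs (dgraph G)" for e x
    using G_tail[OF adm e] G_head[OF adm e] G_fresh[OF adm e, of x] H(1,2)[OF e]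
    by (cases rule: place_cases[OF adm e, of x]) (auto simp: g'_def)
  show thesis
  proof (rule that)
    show "lipschitz_weight w (substitute R G) g'"
      using H(3) by (auto simp: lipschitz_weight_def weight_def place)
  qed (simp add: g'_def)
qed

lemma lipschitz_Xi:
  assumes "lipschitz_weight w (Xi R c0 n) g"
  obtains g' where "lipschitz_weight w (Xi R c0 (n + k)) g'"
    "\<And>x. x \<in> verts (dgraph (Xi R c0 n)) \<Longrightarrow> g' x = lam ^ k * g x"
proof -
  have "\<exists>g'. lipschitz_weight w (Xi R c0 (n + k)) g' \<and>
    (\<forall>x\<in>verts (dgraph (Xi R c0 n)). g' x = lam ^ k * g x)"
  proof (induction k)
    case 0
    then show ?case using assms by auto
  next
    case (Suc k)
    then obtain g' where g': "lipschitz_weight w (Xi R c0 (n + k)) g'"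
      "\<forall>x\<in>verts (dgraph (Xi R c0 n)). g' x = lam ^ k * g x" by blast
    from lipschitz_substitute[OF admissible_Xi g'(1)] obtain g''
      where "lipschitz_weight w (substitute R (Xi R c0 (n + k))) g''"
        "\<And>x. x \<in> verts (dgraph (Xi R c0 (n + k))) \<Longrightarrow> g'' x = lam * g' x" by blast
    moreover have "verts (dgraph (Xi R c0 n)) \<subseteq> verts (dgraph (Xi R c0 (n + k)))"
      by (rule Xi_verts_mono) simp
    ultimately show ?case using g'(2) by (intro exI[of _ g'']) (auto simp: mult_ac)
  qed
  then show thesis using that by blast
qed

lemma uwalk_substitute:
  assumes adm: "admissible n G" and "uwalk (dgraph G) (weight w G) x y s"
  shows "uwalk (dgraph (substitute R G)) (weight w (substitute R G)) x y (lam * s)"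
proof (rule uwalk_map[OF assms(2) wf_substitute[OF adm], where \<phi> = "\<lambda>x. x"])
  fix e assume e: "e \<in> arcs (dgraph G)"
  note i = G_colour[OF adm e]
  from geodesic[OF i] simple_path_imp_uwalk[OF rule_simple[OF i], of _ _ _ "weight w (R (colour G e))"]
  have "uwalk (dgraph (R (colour G e))) (weight w (R (colour G e)))
    (beta_plus (R (colour G e))) (beta_minus (R (colour G e))) (lam * w (colour G e))"
    by metis
  from uwalk_copy[OF adm e this]
  show "uwalk (dgraph (substitute R G)) (weight w (substitute R G))
    (tail (dgraph G) e) (head (dgraph G) e) (lam * weight w G e)"
    by (simp add: place_planting[OF adm e] weight_def)
qed simp

text \<open>Inside its copy every vertex can walk to the planting vertex \<open>beta_plus\<close>,
  which is old. Since there are finitely many rule graphs, \<open>C\<close> depends neither on the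
  level nor on the graph.\<close>

lemma uwalk_to_previous_level:
  obtains C where "C \<ge> 0" "\<And>n G x. admissible n G \<Longrightarrow> x \<in> verts (dgraph (substitute R G)) \<Longrightarrow>
    \<exists>y\<in>verts (dgraph G). \<exists>s\<le>C. uwalk (dgraph (substitute R G)) (weight w (substitute R G)) x y s"
proof -
  have "\<exists>s. uwalk (dgraph (R i)) (weight w (R i)) x (beta_plus (R i)) s"
    if "i < K" "x \<in> verts (dgraph (R i))" for i x
    using connected_imp_uwalk[OF rule_wf rule_connected _ beta_plus_in] that by blast
  then obtain C where C: "C \<ge> 0" "\<And>i x. i < K \<Longrightarrow> x \<in> verts (dgraph (R i)) \<Longrightarrow>
      \<exists>s. \<bar>s\<bar> \<le> C \<and> uwalk (dgraph (R i)) (weight w (R i)) x (beta_plus (R i)) s"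
    using finite_uniform_bound[of "{..<K}" "\<lambda>i. verts (dgraph (R i))"
      "\<lambda>i x s. uwalk (dgraph (R i)) (weight w (R i)) x (beta_plus (R i)) s"] rule_finite(1) by auto
  show thesis
  proof (rule that[OF C(1)])
    fix n G x assume adm: "admissible n G" and "x \<in> verts (dgraph (substitute R G))"
    then consider "x \<in> verts (dgraph G)"
      | e z where "x = place R G e z" "e \<in> arcs (dgraph G)" "z \<in> verts (dgraph (R (colour G e)))" by auto
    then show "\<exists>y\<in>verts (dgraph G). \<exists>s\<le>C.
      uwalk (dgraph (substitute R G)) (weight w (substitute R G)) x y s"
    proof cases
      case 1
      then have "uwalk (dgraph (substitute R G)) (weight w (substitute R G)) x x 0"
        by (intro uwalk.Nil) simp
      with 1 C(1) show ?thesis by blast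
    next
      case 2
      then obtain s where s: "\<bar>s\<bar> \<le> C" "uwalk (dgraph (R (colour G e))) (weight w (R (colour G e)))
        z (beta_plus (R (colour G e))) s" using C(2) G_colour[OF adm] by blast
      from uwalk_copy[OF adm 2(2) s(2)] s(1) G_tail[OF adm 2(2)] show ?thesis
        by (intro bexI[of _ "tail (dgraph G) e"] exI[of _ s]) (auto simp: 2(1) place_planting[OF adm 2(2)])
    qed
  qed
qed

lemma uwalk_Xi_bounded:
  obtains B where "B > 0" "\<And>n x y. x \<in> verts (dgraph (Xi R c0 n)) \<Longrightarrow> y \<in> verts (dgraph (Xi R c0 n)) \<Longrightarrow>
    \<exists>s\<le>B * lam ^ n. uwalk (dgraph (Xi R c0 n)) (weight w (Xi R c0 n)) x y s"
proof -
  obtain C where C: "C \<ge> 0" "\<And>n G x. admissible n G \<Longrightarrow> x \<in> verts (dgraph (substitute R G)) \<Longrightarrow>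
    \<exists>y\<in>verts (dgraph G). \<exists>s\<le>C. uwalk (dgraph (substitute R G)) (weight w (substitute R G)) x y s"
    using uwalk_to_previous_level by metis
  \<comment> \<open>Passing to the next level turns a bound \<open>b\<close> into
    \<open>lam * b + 2 * C\<close>, with fixed point \<open>- D\<close>. Shifting the bound by
    \<open>D\<close> leaves a pure multiplication by \<open>lam\<close>, and \<open>B\<close> is
    chosen so that the shifted bound at level 0 is \<open>w c0\<close>.\<close>
  define D where "D = 2 * C / (lam - 1)"
  have D: "D \<ge> 0" "(lam - 1) * D = 2 * C" using C lam_gt_1 by (auto simp: D_def)
  define B where "B = w c0 + D"
  have w0: "w c0 > 0" using w_pos initial_colour by blast
  then have B: "B > 0" using D by (simp add: B_def)
  have "\<exists>s\<le>B * lam ^ n - D. uwalk (dgraph (Xi R c0 n)) (weight w (Xi R c0 n)) x y s"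
    if "x \<in> verts (dgraph (Xi R c0 n))" "y \<in> verts (dgraph (Xi R c0 n))" for n x y
    using that
  proof (induction n arbitrary: x y)
    case 0
    let ?G = "Xi R c0 0"
    have arc: "[] \<in> arcs (dgraph ?G)" "tail (dgraph ?G) [] = Init_Plus" "head (dgraph ?G) [] = Init_Minus"
      "weight w ?G [] = w c0"
      by (auto simp: initial_graph_def weight_def)
    from uwalk_arc[OF Xi_wf arc(1), of "weight w ?G"]
    have "uwalk (dgraph ?G) (weight w ?G) Init_Plus Init_Minus (w c0)"
      "uwalk (dgraph ?G) (weight w ?G) Init_Minus Init_Plus (w c0)"
      unfolding arc by auto
    moreover have "uwalk (dgraph ?G) (weight w ?G) Init_Plus Init_Plus 0"
      "uwalk (dgraph ?G) (weight w ?G) Init_Minus Init_Minus 0"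
      by (rule uwalk.Nil, rule Init_in_Xi)+
    moreover have "x \<in> {Init_Plus, Init_Minus}" "y \<in> {Init_Plus, Init_Minus}"
      using 0 by (auto simp: initial_graph_def)
    moreover have "B * lam ^ 0 - D = w c0" by (simp add: B_def)
    ultimately show ?case using w0 by (metis empty_iff insert_iff order_refl less_imp_le)
  next
    case (Suc n)
    let ?G = "Xi R c0 n" and ?H = "substitute R (Xi R c0 n)"
    note adm = admissible_Xi[of n]
    obtain x' s where x': "x' \<in> verts (dgraph ?G)" "s \<le> C" "uwalk (dgraph ?H) (weight w ?H) x x' s"
      using C(2)[OF adm] Suc.prems(1) by fastforce
    obtain y' t where y': "y' \<in> verts (dgraph ?G)" "t \<le> C" "uwalk (dgraph ?H) (weight w ?H) y y' t"
      using C(2)[OF adm] Suc.prems(2) by fastforce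
    from Suc.IH[OF x'(1) y'(1)] obtain u where u: "u \<le> B * lam ^ n - D"
      "uwalk (dgraph ?G) (weight w ?G) x' y' u" by blast
    from uwalk_trans[OF uwalk_trans[OF x'(3) uwalk_substitute[OF adm u(2)]]
        uwalk_sym[OF y'(3) wf_substitute[OF adm]]]
    have "uwalk (dgraph ?H) (weight w ?H) x y (s + lam * u + t)" .
    moreover have "s + lam * u + t \<le> B * lam ^ Suc n - D"
    proof -
      have "lam * u \<le> lam * (B * lam ^ n - D)" using u(1) lam_gt_1 by simp
      with x'(2) y'(2) D(2) show ?thesis by (simp add: algebra_simps)
    qed
    ultimately show ?case by auto
  qed
  then show thesis using that[OF B] D(1) by (meson add_increasing2 diff_le_eq dual_order.trans order_refl)
qed

lemma w_bounds:
  obtains a b where "a > 0" "b > 0" "\<And>n e. e \<in> arcs (dgraph (Xi R c0 n)) \<Longrightarrow>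
    a \<le> weight w (Xi R c0 n) e \<and> weight w (Xi R c0 n) e \<le> b"
proof (rule that)
  have ne: "w ` {..<K} \<noteq> {}" using K_pos by (metis image_is_empty initial_colour lessThan_iff empty_iff)
  show "Min (w ` {..<K}) > 0" using ne w_pos by (subst Min_gr_iff) auto
  show "Max (w ` {..<K}) > 0"
    using w_pos initial_colour by (subst Max_gr_iff) auto
  show "Min (w ` {..<K}) \<le> weight w (Xi R c0 n) e \<and> weight w (Xi R c0 n) e \<le> Max (w ` {..<K})"
    if "e \<in> arcs (dgraph (Xi R c0 n))" for n e
    using Xi_arc_colour[OF that] by (auto simp: weight_def)
qed

lemma gdist_Xi_lipschitz:
  obtains b where "b > 0" "\<And>n g x y. lipschitz_weight w (Xi R c0 n) g \<Longrightarrow>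
    x \<in> verts (dgraph (Xi R c0 n)) \<Longrightarrow> y \<in> verts (dgraph (Xi R c0 n)) \<Longrightarrow>
    \<bar>g x - g y\<bar> \<le> b * gdist (dgraph (Xi R c0 n)) x y"
proof -
  obtain a b where ab: "a > 0" "b > 0" "\<And>n e. e \<in> arcs (dgraph (Xi R c0 n)) \<Longrightarrow>
    a \<le> weight w (Xi R c0 n) e \<and> weight w (Xi R c0 n) e \<le> b" using w_bounds by metis
  obtain B where B: "\<And>n x y. x \<in> verts (dgraph (Xi R c0 n)) \<Longrightarrow> y \<in> verts (dgraph (Xi R c0 n)) \<Longrightarrow>
    \<exists>s\<le>B * lam ^ n. uwalk (dgraph (Xi R c0 n)) (weight w (Xi R c0 n)) x y s" using uwalk_Xi_bounded by metis
  show thesis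
  proof (rule that[OF ab(2)])
    fix n g x y assume g: "lipschitz_weight w (Xi R c0 n) g"
      and xy: "x \<in> verts (dgraph (Xi R c0 n))" "y \<in> verts (dgraph (Xi R c0 n))"
    from B[OF xy] obtain s where "uwalk (dgraph (Xi R c0 n)) (weight w (Xi R c0 n)) x y s" by blast
    then show "\<bar>g x - g y\<bar> \<le> b * gdist (dgraph (Xi R c0 n)) x y"
      by (rule gdist_lipschitz[OF Xi_wf _ ab(2)])
        (use g ab(3) in \<open>fastforce simp: lipschitz_weight_def\<close>)
  qed
qed

text \<open>The upper bound divides the weighted lengths of walks by the smallest edge length. The
  lower bound already holds for the two initial vertices, separated by the extension of a Lipschitz
  function on the initial edge.\<close>

lemma gdiam_Xi:
  obtains a b where "a > 0" "b > 0" "\<And>n. a * lam ^ n \<le> gdiam (dgraph (Xi R c0 n))"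
    "\<And>n. gdiam (dgraph (Xi R c0 n)) \<le> b * lam ^ n"
proof -
  obtain a b where ab: "a > 0" "b > 0" "\<And>n e. e \<in> arcs (dgraph (Xi R c0 n)) \<Longrightarrow>
    a \<le> weight w (Xi R c0 n) e \<and> weight w (Xi R c0 n) e \<le> b" using w_bounds by metis
  obtain B where B: "B > 0" "\<And>n x y. x \<in> verts (dgraph (Xi R c0 n)) \<Longrightarrow> y \<in> verts (dgraph (Xi R c0 n)) \<Longrightarrow>
    \<exists>s\<le>B * lam ^ n. uwalk (dgraph (Xi R c0 n)) (weight w (Xi R c0 n)) x y s" using uwalk_Xi_bounded by metis
  obtain M where M: "M > 0" "\<And>n g x y. lipschitz_weight w (Xi R c0 n) g \<Longrightarrow>
    x \<in> verts (dgraph (Xi R c0 n)) \<Longrightarrow> y \<in> verts (dgraph (Xi R c0 n)) \<Longrightarrow>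
    \<bar>g x - g y\<bar> \<le> M * gdist (dgraph (Xi R c0 n)) x y" using gdist_Xi_lipschitz by metis
  let ?S = "\<lambda>n. {gdist (dgraph (Xi R c0 n)) x y | x y. x \<in> verts (dgraph (Xi R c0 n)) \<and> y \<in> verts (dgraph (Xi R c0 n))}"
  have fin: "finite (?S n)" for n
    using underlying_simpleD(2)[OF Xi_simple, of n] by (intro finite_image_set2) auto
  have w0: "w c0 > 0" using w_pos initial_colour by blast
  show thesis
  proof (rule that[of "w c0 / M" "B / a"])
    show "w c0 / M > 0" "B / a > 0" using w0 M(1) B(1) ab(1) by auto
    fix n
    define g where "g x = (if x = (Init_Minus :: ('v, 'e) iter_vertex) then w c0 else 0)" for x
    have "lipschitz_weight w (Xi R c0 0) g"
      using w0 by (auto simp: lipschitz_weight_def weight_def initial_graph_def g_def)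
    from lipschitz_Xi[OF this, of n] obtain g' where g': "lipschitz_weight w (Xi R c0 n) g'"
      "\<And>x. x \<in> verts (dgraph (Xi R c0 0)) \<Longrightarrow> g' x = lam ^ n * g x" by auto
    have "w c0 * lam ^ n = \<bar>g' Init_Plus - g' Init_Minus\<bar>"
      using w0 lam_gt_1 by (simp add: g'(2) Init_in_Xi(1,2)[of 0, simplified] g_def abs_mult mult_ac)
    also have "\<dots> \<le> M * gdist (dgraph (Xi R c0 n)) Init_Plus Init_Minus"
      by (rule M(2)[OF g'(1) Init_in_Xi])
    also have "\<dots> \<le> M * gdiam (dgraph (Xi R c0 n))"
      unfolding gdiam_def using fin Init_in_Xi by (intro mult_left_mono Max_ge less_imp_le[OF M(1)]) blast+
    finally show "w c0 / M * lam ^ n \<le> gdiam (dgraph (Xi R c0 n))"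
      using M(1) by (simp add: field_simps)
    show "gdiam (dgraph (Xi R c0 n)) \<le> B / a * lam ^ n"
      unfolding gdiam_def
    proof (rule Max.boundedI[OF fin])
      show "?S n \<noteq> {}" using Init_in_Xi[of n] by blast
      fix d assume "d \<in> ?S n"
      then obtain x y where xy: "x \<in> verts (dgraph (Xi R c0 n))" "y \<in> verts (dgraph (Xi R c0 n))"
        "d = gdist (dgraph (Xi R c0 n)) x y" by blast
      from B(2)[OF xy(1,2)] obtain s where s: "s \<le> B * lam ^ n"
        "uwalk (dgraph (Xi R c0 n)) (weight w (Xi R c0 n)) x y s" by blast
      have "a * d \<le> s" unfolding xy(3) by (rule gdist_le_uwalk[OF Xi_wf s(2) ab(1)]) (use ab(3) in auto)
      with s(1) ab(1) show "d \<le> B / a * lam ^ n" by (simp add: field_simps)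
    qed
  qed
qed

end

section \<open>Resistance growth\<close>

lemma tendsto_divide_nat:
  assumes "eventually (\<lambda>n. \<bar>x n - real n * c\<bar> \<le> M) sequentially"
  shows "(\<lambda>n. x n / real n) \<longlonglongrightarrow> c"
proof -
  have "(\<lambda>n. x n / real n - c) \<longlonglongrightarrow> 0"
  proof (rule tendsto_0_le)
    show "eventually (\<lambda>n. norm (x n / real n - c) \<le> norm (M / real n) * 1) sequentially"
      using assms eventually_gt_at_top[of 0]
    proof eventually_elim
      case (elim n)
      then have "x n / real n - c = (x n - real n * c) / real n" by (simp add: field_simps)
      with elim show ?case by (simp add: abs_divide divide_right_mono)
    qed
    show "(\<lambda>n. M / real n) \<longlonglongrightarrow> 0" by (rule lim_const_over_n)
  qed
  then show ?thesis by (simp add: LIM_zero_iff)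
qed

lemma ln_close_to_linear:
  fixes q :: real
  assumes q: "q > 0" and a: "a > 0" and x: "a * q ^ n \<le> x" "x \<le> b * q ^ n"
  shows "\<bar>ln x - real n * ln q\<bar> \<le> \<bar>ln a\<bar> + \<bar>ln b\<bar>"
proof -
  have qn: "q ^ n > 0" using q by simp
  then have "0 < a * q ^ n" using a by simp
  with x have x0: "x > 0" "b * q ^ n > 0" by linarith+
  from zero_less_mult_pos2[OF x0(2) qn] have b: "b > 0" .
  have "ln (a * q ^ n) \<le> ln x" "ln x \<le> ln (b * q ^ n)"
    using x x0 \<open>0 < a * q ^ n\<close> by (auto simp: ln_le_cancel_iff)
  then show ?thesis using a b q qn by (simp add: ln_mult ln_realpow)
qed

text \<open>Both logarithms are linear in \<open>n\<close> up to a bounded error, with slopes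
  \<open>- ln r\<close> and \<open>ln lam\<close>; dividing both by \<open>n\<close> removes the
  constants and the radius \<rho>.\<close>

lemma log_ratio_limit:
  fixes F D :: "nat \<Rightarrow> real"
  assumes "r > 0" "lam > 1" "a > 0" "c > 0" "\<rho> > 0"
    and F: "eventually (\<lambda>n. a \<le> F n * r ^ n \<and> F n * r ^ n \<le> b) sequentially"
    and D: "\<And>n. c * lam ^ n \<le> D n" "\<And>n. D n \<le> d * lam ^ n"
  shows "(\<lambda>n. ln (F n) / (- ln (\<rho> / D n))) \<longlonglongrightarrow> - (ln r / ln lam)"
proof -
  have "(\<lambda>n. ln (F n) / real n) \<longlonglongrightarrow> - ln r"
  proof (rule tendsto_divide_nat)
    show "eventually (\<lambda>n. \<bar>ln (F n) - real n * - ln r\<bar> \<le> \<bar>ln a\<bar> + \<bar>ln b\<bar>) sequentially"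
      using F
    proof eventually_elim
      case (elim n)
      have "a * inverse r ^ n \<le> F n" "F n \<le> b * inverse r ^ n"
        using elim \<open>r > 0\<close> by (simp_all add: field_simps power_inverse)
      from ln_close_to_linear[OF _ \<open>a > 0\<close> this] show ?case using \<open>r > 0\<close> by (simp add: ln_inverse)
    qed
  qed
  moreover have "(\<lambda>n. - ln (\<rho> / D n) / real n) \<longlonglongrightarrow> ln lam"
  proof (rule tendsto_divide_nat)
    show "eventually (\<lambda>n. \<bar>- ln (\<rho> / D n) - real n * ln lam\<bar> \<le> \<bar>ln c\<bar> + \<bar>ln d\<bar> + \<bar>ln \<rho>\<bar>) sequentially"
    proof (rule always_eventually, rule allI)
      fix n
      have "0 < c * lam ^ n" using \<open>c > 0\<close> \<open>lam > 1\<close> by simp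
      then have "D n > 0" using D(1)[of n] by linarith
      then have "- ln (\<rho> / D n) = ln (D n) - ln \<rho>" using \<open>\<rho> > 0\<close> by (simp add: ln_div)
      moreover have "\<bar>ln (D n) - real n * ln lam\<bar> \<le> \<bar>ln c\<bar> + \<bar>ln d\<bar>"
        using \<open>lam > 1\<close> by (intro ln_close_to_linear[OF _ \<open>c > 0\<close> D]) simp
      ultimately show "\<bar>- ln (\<rho> / D n) - real n * ln lam\<bar> \<le> \<bar>ln c\<bar> + \<bar>ln d\<bar> + \<bar>ln \<rho>\<bar>" by linarith
    qed
  qed
  ultimately have "(\<lambda>n. (ln (F n) / real n) / (- ln (\<rho> / D n) / real n)) \<longlonglongrightarrow> - ln r / ln lam"
    using \<open>lam > 1\<close> by (intro tendsto_divide) auto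
  then have "(\<lambda>n. (ln (F n) / real n) / (- ln (\<rho> / D n) / real n)) \<longlonglongrightarrow> - (ln r / ln lam)" by simp
  then show ?thesis
  proof (rule Lim_transform_eventually)
    show "eventually (\<lambda>n. (ln (F n) / real n) / (- ln (\<rho> / D n) / real n) = ln (F n) / (- ln (\<rho> / D n))) sequentially"
      using eventually_gt_at_top[of 0] by eventually_elim simp
  qed
qed

section \<open>Distances and degrees around a fixed vertex\<close>

context geodesic_eigs
begin

text \<open>A spike at \<open>y\<close> whose height is the smallest edge length is Lipschitz at
  level \<open>n\<close>, and its extension by \<open>k\<close> levels grows by
  \<open>lam ^ k\<close>. The smallest edge length depends only on the colours, so the constant is
  uniform in \<open>n\<close>.\<close>

lemma gdist_Xi_ge:
  obtains a where "a > 0" "\<And>n k x y. x \<in> verts (dgraph (Xi R c0 n)) \<Longrightarrow> y \<in> verts (dgraph (Xi R c0 n)) \<Longrightarrow>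
    x \<noteq> y \<Longrightarrow> a * lam ^ k \<le> gdist (dgraph (Xi R c0 (n + k))) x y"
proof -
  obtain a b where ab: "a > 0" "b > 0" "\<And>n e. e \<in> arcs (dgraph (Xi R c0 n)) \<Longrightarrow>
    a \<le> weight w (Xi R c0 n) e \<and> weight w (Xi R c0 n) e \<le> b" using w_bounds by metis
  obtain M where M: "M > 0" "\<And>n g x y. lipschitz_weight w (Xi R c0 n) g \<Longrightarrow>
    x \<in> verts (dgraph (Xi R c0 n)) \<Longrightarrow> y \<in> verts (dgraph (Xi R c0 n)) \<Longrightarrow>
    \<bar>g x - g y\<bar> \<le> M * gdist (dgraph (Xi R c0 n)) x y" using gdist_Xi_lipschitz by metis
  show thesis
  proof (rule that[of "a / M"])
    show "a / M > 0" using ab(1) M(1) by simp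
    fix n k x y assume xy: "x \<in> verts (dgraph (Xi R c0 n))" "y \<in> verts (dgraph (Xi R c0 n))" "x \<noteq> y"
    define g where "g z = (if z = y then a else 0)" for z
    have "lipschitz_weight w (Xi R c0 n) g"
      using ab(1,3) by (fastforce simp: lipschitz_weight_def g_def)
    from lipschitz_Xi[OF this, of k] obtain g' where g': "lipschitz_weight w (Xi R c0 (n + k)) g'"
      "\<And>x. x \<in> verts (dgraph (Xi R c0 n)) \<Longrightarrow> g' x = lam ^ k * g x" by auto
    have "a * lam ^ k = \<bar>g' x - g' y\<bar>"
      using ab(1) lam_gt_1 xy by (simp add: g'(2) g_def abs_mult mult_ac)
    also have "\<dots> \<le> M * gdist (dgraph (Xi R c0 (n + k))) x y"
      using M(2)[OF g'(1)] xy Xi_verts_mono[of n "n + k"] by auto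
    finally show "a / M * lam ^ k \<le> gdist (dgraph (Xi R c0 (n + k))) x y"
      using M(1) by (simp add: field_simps)
  qed
qed

lemma ex_incident_arc:
  assumes "v \<in> verts (dgraph (Xi R c0 n))"
  shows "\<exists>e\<in>arcs (dgraph (Xi R c0 n)). tail (dgraph (Xi R c0 n)) e = v \<or> head (dgraph (Xi R c0 n)) e = v"
proof -
  obtain u where u: "u \<in> verts (dgraph (Xi R c0 n))" "u \<noteq> v"
    using Init_in_Xi[of n] by (metis iter_vertex.distinct(1))
  obtain B where B: "\<And>n x y. x \<in> verts (dgraph (Xi R c0 n)) \<Longrightarrow> y \<in> verts (dgraph (Xi R c0 n)) \<Longrightarrow>
    \<exists>s\<le>B * lam ^ n. uwalk (dgraph (Xi R c0 n)) (weight w (Xi R c0 n)) x y s" using uwalk_Xi_bounded by metis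
  from B[OF assms u(1)] obtain s where "uwalk (dgraph (Xi R c0 n)) (weight w (Xi R c0 n)) v u s" by blast
  then show ?thesis using u(2) by (cases rule: uwalk.cases) auto
qed

text \<open>The degree of \<open>v\<close>, as a sum of indicators so that it can be compared term
  by term with both the energy and \<open>degree_sum\<close>.\<close>

definition incident :: "nat \<Rightarrow> ('v, 'e) iter_vertex \<Rightarrow> real" where
  "incident n v = (\<Sum>e\<in>arcs (dgraph (Xi R c0 n)).
     if tail (dgraph (Xi R c0 n)) e = v \<or> head (dgraph (Xi R c0 n)) e = v then 1 else 0)"

text \<open>Only the values on the vertices of level \<open>n\<close> are prescribed, so the lemma
  also applies to a function that was chosen at a later level.\<close>

lemma energy_point:
  assumes "f v = 1" "\<And>u. u \<in> verts (dgraph (Xi R c0 n)) \<Longrightarrow> u \<noteq> v \<Longrightarrow> f u = 0"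
  shows "energy (dgraph (Xi R c0 n)) f = incident n v"
  unfolding energy_eq_sum_arcs[OF Xi_simple] incident_def
proof (rule sum.cong[OF refl])
  fix e assume e: "e \<in> arcs (dgraph (Xi R c0 n))"
  then have "tail (dgraph (Xi R c0 n)) e \<in> verts (dgraph (Xi R c0 n))"
    "head (dgraph (Xi R c0 n)) e \<in> verts (dgraph (Xi R c0 n))"
    "tail (dgraph (Xi R c0 n)) e \<noteq> head (dgraph (Xi R c0 n)) e"
    using Xi_wf[of n] underlying_simpleD(4)[OF Xi_simple] by (auto simp: wf_digraph_def)
  with assms show "(f (tail (dgraph (Xi R c0 n)) e) - f (head (dgraph (Xi R c0 n)) e))\<^sup>2 =
    (if tail (dgraph (Xi R c0 n)) e = v \<or> head (dgraph (Xi R c0 n)) e = v then 1 else 0)"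
    by (cases "tail (dgraph (Xi R c0 n)) e = v"; cases "head (dgraph (Xi R c0 n)) e = v") auto
qed

lemma incident_growth:
  assumes v: "v \<in> verts (dgraph (Xi R c0 n0))" and r: "r > 0"
    and y: "\<And>k. k < 2 * K \<Longrightarrow> y k > 0"
    and plus: "\<And>i. i < K \<Longrightarrow> degree_sum y (R i) (beta_plus (R i)) = r * y (2 * i)"
    and minus: "\<And>i. i < K \<Longrightarrow> degree_sum y (R i) (beta_minus (R i)) = r * y (2 * i + 1)"
  obtains a b where "a > 0" "b > 0" "\<And>n. n \<ge> n0 \<Longrightarrow> a * r ^ n \<le> incident n v \<and> incident n v \<le> b * r ^ n"
proof -
  have ne: "y ` {..<2 * K} \<noteq> {}" using K_pos by (auto simp: lessThan_empty_iff)
  define lo where "lo = Min (y ` {..<2 * K})"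
  define hi where "hi = Max (y ` {..<2 * K})"
  have lohi: "lo \<le> y k" "y k \<le> hi" if "k < 2 * K" for k using that by (auto simp: lo_def hi_def)
  have lo: "lo > 0" unfolding lo_def using ne y by (subst Min_gr_iff) auto
  have "0 < 2 * K" using K_pos by simp
  from lohi[OF this] lo have hi: "hi > 0" by linarith
  have cmp: "lo * incident n v \<le> degree_sum y (Xi R c0 n) v \<and> degree_sum y (Xi R c0 n) v \<le> hi * incident n v" for n
    unfolding incident_def degree_sum_def sum_distrib_left
  proof (intro conjI sum_mono)
    fix e assume e: "e \<in> arcs (dgraph (Xi R c0 n))"
    have c: "2 * colour (Xi R c0 n) e < 2 * K" "2 * colour (Xi R c0 n) e + 1 < 2 * K"
      using Xi_arc_colour[OF e] by auto
    \<comment> \<open>There are no loops, so an incident arc contributes at exactly one of its ends;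
      hence the upper factor is \<open>hi\<close> and not \<open>2 * hi\<close>.\<close>
    note l = lohi[OF c(1)] lohi[OF c(2)] underlying_simpleD(4)[OF Xi_simple e]
    let ?t = "tail (dgraph (Xi R c0 n)) e" and ?h = "head (dgraph (Xi R c0 n)) e"
    show "lo * (if ?t = v \<or> ?h = v then 1 else 0) \<le>
      (if ?t = v then y (2 * colour (Xi R c0 n) e) else 0) + (if ?h = v then y (2 * colour (Xi R c0 n) e + 1) else 0)"
      "(if ?t = v then y (2 * colour (Xi R c0 n) e) else 0) + (if ?h = v then y (2 * colour (Xi R c0 n) e + 1) else 0)
       \<le> hi * (if ?t = v \<or> ?h = v then 1 else 0)"
      using l by auto
  qed
  define W where "W = degree_sum y (Xi R c0 n0) v"
  have "incident n0 v > 0"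
  proof -
    obtain e where "e \<in> arcs (dgraph (Xi R c0 n0))"
      "tail (dgraph (Xi R c0 n0)) e = v \<or> head (dgraph (Xi R c0 n0)) e = v"
      using ex_incident_arc[OF v] by blast
    then show ?thesis unfolding incident_def
      using underlying_simpleD(3)[OF Xi_simple, of n0] by (intro sum_pos2[of _ e]) auto
  qed
  then have W: "W > 0" using cmp[of n0] lo unfolding W_def by (meson less_le_trans mult_pos_pos)
  show thesis
  proof (rule that[of "W / (hi * r ^ n0)" "W / (lo * r ^ n0)"])
    show "W / (hi * r ^ n0) > 0" "W / (lo * r ^ n0) > 0" using W lo hi r by auto
    fix n assume "n \<ge> n0"
    then obtain k where k: "n = n0 + k" using le_Suc_ex by blast
    have "degree_sum y (Xi R c0 n) v = r ^ k * W"
      unfolding k W_def by (rule degree_sum_Xi[OF v plus minus])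
    with cmp[of n] lo hi r
    show "W / (hi * r ^ n0) * r ^ n \<le> incident n v \<and> incident n v \<le> W / (lo * r ^ n0) * r ^ n"
      by (simp add: k power_add field_simps)
  qed
qed

lemma resistance_growth:
  assumes v: "v \<in> verts (dgraph (Xi R c0 n0))" and r: "r > 0" and rad: "rad > 1"
    and y: "\<And>k. k < 2 * K \<Longrightarrow> y k > 0"
    and plus: "\<And>i. i < K \<Longrightarrow> degree_sum y (R i) (beta_plus (R i)) = r * y (2 * i)"
    and minus: "\<And>i. i < K \<Longrightarrow> degree_sum y (R i) (beta_minus (R i)) = r * y (2 * i + 1)"
  shows "\<exists>a b. a > 0 \<and> eventually (\<lambda>n.
    a \<le> resistance (dgraph (Xi R c0 n)) v (gball (dgraph (Xi R c0 n)) v rad) * r ^ n \<and>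
    resistance (dgraph (Xi R c0 n)) v (gball (dgraph (Xi R c0 n)) v rad) * r ^ n \<le> b) sequentially"
proof -
  obtain a b where ab: "a > 0" "b > 0"
    "\<And>n. n \<ge> n0 \<Longrightarrow> a * r ^ n \<le> incident n v \<and> incident n v \<le> b * r ^ n"
    using incident_growth[OF v r y plus minus] by metis
  obtain L where L: "L > 0"
    "\<And>n k f. energy (dgraph (Xi R c0 n)) f \<le> L ^ k * energy (dgraph (Xi R c0 (n + k))) f"
    using energy_contraction by metis
  obtain c where c: "c > 0" "\<And>n k x y. x \<in> verts (dgraph (Xi R c0 n)) \<Longrightarrow> y \<in> verts (dgraph (Xi R c0 n)) \<Longrightarrow>
    x \<noteq> y \<Longrightarrow> c * lam ^ k \<le> gdist (dgraph (Xi R c0 (n + k))) x y" using gdist_Xi_ge by metis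
  \<comment> \<open>From \<open>m\<close> levels on, distinct old vertices are at distance at least
    \<open>rad\<close>; so the open ball at level \<open>k + m\<close> contains no vertex of level
    \<open>k\<close> other than \<open>v\<close>.\<close>
  obtain m where "rad / c < lam ^ m" using real_arch_pow[OF lam_gt_1] by blast
  then have m: "rad \<le> c * lam ^ m" using c(1) by (simp add: field_simps)
  \<comment> \<open>Descending \<open>m\<close> levels costs at most \<open>L ^ m\<close> in energy,
    and the degree bound \<open>a * r ^ (n - m)\<close> is rewritten in terms of
    \<open>r ^ n\<close>.\<close>
  define q where "q = a / (L ^ m * r ^ m)"
  have q: "q > 0" using ab L r by (simp add: q_def)
  have "1 / b \<le> resistance (dgraph (Xi R c0 n)) v (gball (dgraph (Xi R c0 n)) v rad) * r ^ n \<and>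
    resistance (dgraph (Xi R c0 n)) v (gball (dgraph (Xi R c0 n)) v rad) * r ^ n \<le> 1 / q"
    if n: "n \<ge> n0 + m" for n
  proof -
    let ?G = "dgraph (Xi R c0 n)"
    let ?S = "{energy ?G f | f. f v = 1 \<and> (\<forall>u\<in>verts ?G - gball ?G v rad. f u = 0)}"
    define k where "k = n - m"
    have k: "n = k + m" "k \<ge> n0" using n by (auto simp: k_def)
    have vk: "v \<in> verts (dgraph (Xi R c0 k))" "v \<in> verts ?G"
      using v Xi_verts_mono[of n0 k] Xi_verts_mono[of n0 n] k by auto
    have "gdist ?G v v \<le> 0"
      using gdist_le_uwalk[OF Xi_wf uwalk.Nil[OF vk(2), of "\<lambda>_. 1"], of 1] by simp
    then have ball: "v \<in> gball ?G v rad" using rad vk(2) by (simp add: gball_def)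
    define \<delta> where "\<delta> u = (if u = v then 1 else 0 :: real)" for u
    have mem: "incident n v \<in> ?S"
      using ball energy_point[of \<delta> v n] by (auto simp: \<delta>_def intro!: exI[of _ \<delta>])
    have lower: "q * r ^ n \<le> s" if "s \<in> ?S" for s
    proof -
      from that obtain f where f: "s = energy ?G f" "f v = 1"
        "\<And>u. u \<in> verts ?G \<Longrightarrow> u \<notin> gball ?G v rad \<Longrightarrow> f u = 0" by blast
      have "f u = 0" if u: "u \<in> verts (dgraph (Xi R c0 k))" "u \<noteq> v" for u
      proof (rule f(3))
        show "u \<in> verts ?G" using u Xi_verts_mono[of k n] k by auto
        show "u \<notin> gball ?G v rad"
          using c(2)[OF vk(1) u(1), of m] u(2) m k(1) by (auto simp: gball_def)
      qed
      from energy_point[of f v k, OF f(2) this] have "incident k v \<le> L ^ m * s"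
        using L(2)[of k f m] f(1) k(1) by simp
      moreover have "a * r ^ k \<le> incident k v" using ab(3)[OF k(2)] by simp
      ultimately have "a * r ^ k \<le> L ^ m * s" by simp
      then show ?thesis using L(1) r by (simp add: q_def k(1) power_add field_simps)
    qed
    have "q * r ^ n \<le> Inf ?S" by (rule cInf_greatest) (use mem lower in auto)
    moreover have "Inf ?S \<le> incident n v" by (rule cInf_lower[OF mem]) (use lower in \<open>auto intro!: bdd_belowI\<close>)
    moreover have "incident n v \<le> b * r ^ n" using ab(3)[of n] n by simp
    moreover have "q * r ^ n > 0" using q r by simp
    \<comment> \<open>Positivity of the infimum is what lets \<open>inverse\<close> reverse the
      bounds; it also excludes the degenerate case of a ball that contains all vertices.\<close>
    ultimately have I: "0 < Inf ?S" "q * r ^ n \<le> Inf ?S" "Inf ?S \<le> b * r ^ n" by linarith+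
    show ?thesis
      unfolding resistance_def using I q ab(2) r by (simp add: field_simps)
  qed
  then show ?thesis using ab(2)
    by (intro exI[of _ "1 / b"] exI[of _ "1 / q"]) (auto simp: eventually_sequentially)
qed

lemma has_local_resistance_dim_Xi:
  assumes v: "v \<in> Xi_verts R c0" and r: "r > 0"
    and y: "\<And>k. k < 2 * K \<Longrightarrow> y k > 0"
    and plus: "\<And>i. i < K \<Longrightarrow> degree_sum y (R i) (beta_plus (R i)) = r * y (2 * i)"
    and minus: "\<And>i. i < K \<Longrightarrow> degree_sum y (R i) (beta_minus (R i)) = r * y (2 * i + 1)"
  shows "has_local_resistance_dim (\<lambda>n. dgraph (Xi R c0 n)) v (- (ln r / ln lam))"
  unfolding has_local_resistance_dim_def
proof (intro allI impI)
  fix rad :: real assume rad: "rad > 1"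
  obtain n0 where n0: "v \<in> verts (dgraph (Xi R c0 n0))" using v by (auto simp: Xi_verts_def)
  obtain c d where cd: "c > 0" "\<And>n. c * lam ^ n \<le> gdiam (dgraph (Xi R c0 n))"
    "\<And>n. gdiam (dgraph (Xi R c0 n)) \<le> d * lam ^ n" using gdiam_Xi by metis
  from resistance_growth[OF n0 r rad y plus minus] obtain a b where ab: "a > 0" "eventually (\<lambda>n.
    a \<le> resistance (dgraph (Xi R c0 n)) v (gball (dgraph (Xi R c0 n)) v rad) * r ^ n \<and>
    resistance (dgraph (Xi R c0 n)) v (gball (dgraph (Xi R c0 n)) v rad) * r ^ n \<le> b) sequentially"
    by blast
  show "(\<lambda>n. ln (resistance (dgraph (Xi R c0 n)) v (gball (dgraph (Xi R c0 n)) v rad)) /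
      (- ln (rad / gdiam (dgraph (Xi R c0 n))))) \<longlonglongrightarrow> - (ln r / ln lam)"
    by (rule log_ratio_limit[OF r lam_gt_1 ab(1) cd(1) _ ab(2) cd(2,3)]) (use rad in simp)
qed

end

section \<open>Eigenvectors as edge weights\<close>

lemma sum_card_colour:
  fixes F :: "nat \<Rightarrow> real"
  assumes "finite A" "\<And>e. e \<in> A \<Longrightarrow> c e < K"
  shows "(\<Sum>j<K. real (card {e \<in> A. c e = j}) * F j) = (\<Sum>e\<in>A. F (c e))"
proof -
  have "(\<Sum>e\<in>A. F (c e)) = (\<Sum>j<K. \<Sum>e\<in>{e \<in> A. c e = j}. F (c e))"
    using assms by (intro sum.group[symmetric]) auto
  then show ?thesis by simp
qed

lemma sum_even_odd:
  fixes F :: "nat \<Rightarrow> real"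
  shows "(\<Sum>k<2 * K. F k) = (\<Sum>j<K. F (2 * j)) + (\<Sum>j<K. F (2 * j + 1))"
  by (induction K) auto

text \<open>Grouping the arcs at \<open>v\<close> by colour and direction recovers the entries that
  make up the degree matrix.\<close>

lemma degree_sum_kappa:
  assumes "finite (arcs (dgraph G))" "\<And>e. e \<in> arcs (dgraph G) \<Longrightarrow> colour G e < K"
  shows "degree_sum y G v = (\<Sum>k<2 * K. real (kappa G v k) * y k)"
proof -
  have out: "(\<Sum>j<K. real (kappa G v (2 * j)) * y (2 * j)) =
    (\<Sum>e\<in>arcs (dgraph G). if tail (dgraph G) e = v then y (2 * colour G e) else 0)"
    using sum_card_colour[of "out_arcs (dgraph G) v" "colour G" K "\<lambda>j. y (2 * j)"] assms
    by (simp add: kappa_def out_arcs_def sum.If_cases Int_def)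
  have inn: "(\<Sum>j<K. real (kappa G v (2 * j + 1)) * y (2 * j + 1)) =
    (\<Sum>e\<in>arcs (dgraph G). if head (dgraph G) e = v then y (2 * colour G e + 1) else 0)"
    using sum_card_colour[of "in_arcs (dgraph G) v" "colour G" K "\<lambda>j. y (2 * j + 1)"] assms
    by (simp add: kappa_def in_arcs_def sum.If_cases Int_def)
  show ?thesis unfolding sum_even_odd out inn degree_sum_def sum.distrib ..
qed

context eigs
begin

definition path_matrix :: "(nat \<Rightarrow> ('v \<times> 'v) awalk) \<Rightarrow> nat mat" where
  "path_matrix P = mat K K (\<lambda>(i, j). card {e \<in> path_arcs (dgraph (R i)) (P i). colour (R i) e = j})"

text \<open>Paths are chosen independently for each colour, so that a single row can be exchanged.
  Values from \<open>K\<close> on are arbitrary; the matrices are finite in number because only the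
  restriction to \<open>{..<K}\<close> affects them.\<close>

definition path_choices :: "(nat \<Rightarrow> ('v \<times> 'v) awalk) set" where
  "path_choices = {P. \<forall>i<K. P i \<in> simple_paths (dgraph (R i)) (beta_plus (R i)) (beta_minus (R i))}"

lemma distance_matrices_eq: "distance_matrices K R = path_matrix ` path_choices"
  by (auto simp: distance_matrices_def path_matrix_def path_choices_def)

lemma path_matrix_carrier: "path_matrix P \<in> carrier_mat K K"
  by (simp add: path_matrix_def)

lemma path_matrix_row:
  assumes "i < K"
  shows "(\<Sum>j<K. real (path_matrix P $$ (i, j)) * u j) =
    (\<Sum>e\<in>path_arcs (dgraph (R i)) (P i). weight u (R i) e)"
proof -
  have "finite (path_arcs (dgraph (R i)) (P i))"
    using underlying_simpleD(3)[OF rule_simple[OF assms]] by (simp add: path_arcs_def)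
  from sum_card_colour[OF this, of "colour (R i)" K u] rule_colour[OF assms] assms
  show ?thesis by (simp add: path_matrix_def weight_def path_arcs_def)
qed

lemma ex_simple_path:
  assumes "i < K"
  shows "\<exists>p. p \<in> simple_paths (dgraph (R i)) (beta_plus (R i)) (beta_minus (R i))"
proof -
  obtain s where "uwalk (dgraph (R i)) (\<lambda>_. 1) (beta_plus (R i)) (beta_minus (R i)) s"
    using connected_imp_uwalk[OF underlying_simpleD(1)[OF rule_simple] rule_connected beta_plus_in beta_minus_in]
      assms by blast
  from uwalk_imp_simple_path[OF rule_simple[OF assms] this] show ?thesis by auto
qed

lemma path_choices_nonempty: "path_choices \<noteq> {}"
proof -
  obtain P where "\<And>i. i < K \<Longrightarrow> P i \<in> simple_paths (dgraph (R i)) (beta_plus (R i)) (beta_minus (R i))"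
    using ex_simple_path by metis
  then show ?thesis by (auto simp: path_choices_def)
qed

lemma path_choices_upd:
  "P \<in> path_choices \<Longrightarrow> p \<in> simple_paths (dgraph (R i)) (beta_plus (R i)) (beta_minus (R i)) \<Longrightarrow>
    P(i := p) \<in> path_choices"
  by (auto simp: path_choices_def)

lemma finite_distance_matrices: "finite (distance_matrices K R)"
proof -
  let ?Q = "PiE {..<K} (\<lambda>i. simple_paths (dgraph (R i)) (beta_plus (R i)) (beta_minus (R i)))"
  have "distance_matrices K R \<subseteq> path_matrix ` ?Q"
  proof
    fix D assume "D \<in> distance_matrices K R"
    then obtain P where P: "P \<in> path_choices" "D = path_matrix P" by (auto simp: distance_matrices_eq)
    then have "D = path_matrix (restrict P {..<K})" by (auto simp: path_matrix_def intro!: eq_matI)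
    moreover have "restrict P {..<K} \<in> ?Q" using P(1) by (auto simp: path_choices_def)
    ultimately show "D \<in> path_matrix ` ?Q" by blast
  qed
  moreover have "finite ?Q" using finite_simple_paths[OF rule_simple] by (intro finite_PiE) auto
  ultimately show ?thesis using finite_surj by blast
qed

text \<open>An arc joining the planting vertices would itself be a simple path, whose row is zero
  except in the colour of that arc. Positive entries then leave only \<open>K = 1\<close>, where the
  planting distance of at least 2 gives the contradiction.\<close>

lemma separated_if_distance_positive:
  assumes "distance_positive K R"
  shows "separated_eigs K R c0"
proof (unfold_locales, rule notI)
  fix i e
  assume i: "i < K" and e: "e \<in> arcs (dgraph (R i))"
    and ends: "{tail (dgraph (R i)) e, head (dgraph (R i)) e} = {beta_plus (R i), beta_minus (R i)}"
  note S = rule_simple[OF i]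
  have uw: "uwalk (dgraph (R i)) w (beta_plus (R i)) (beta_minus (R i)) (w e)" for w
    using uwalk_arc[OF underlying_simpleD(1)[OF S] e, of w] ends by (auto simp: doubleton_eq_iff)
  \<comment> \<open>With cost 0 on \<open>e\<close> and 1 elsewhere, the simple path extracted from
    the walk along \<open>e\<close> has total cost 0 and can use no other arc.\<close>
  define g where "g f = (if f = e then 0 else 1 :: real)" for f
  obtain p where p: "p \<in> simple_paths (dgraph (R i)) (beta_plus (R i)) (beta_minus (R i))"
    "(\<Sum>f\<in>path_arcs (dgraph (R i)) p. g f) \<le> 0"
    using uwalk_imp_simple_path[OF S uw[of g]] by (force simp: g_def)
  have fin: "finite (path_arcs (dgraph (R i)) p)"
    using underlying_simpleD(3)[OF S] by (simp add: path_arcs_def)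
  then have only: "f = e" if "f \<in> path_arcs (dgraph (R i)) p" for f
  proof -
    have "g f \<le> (\<Sum>f\<in>path_arcs (dgraph (R i)) p. g f)"
      using that fin by (intro member_le_sum) (auto simp: g_def)
    with p(2) have "g f \<le> 0" by linarith
    then show ?thesis by (simp add: g_def split: if_splits)
  qed
  obtain P where "P \<in> path_choices" using path_choices_nonempty by blast
  from path_choices_upd[OF this p(1)] have "positive_entries (path_matrix (P(i := p)))"
    using assms by (auto simp: distance_positive_def distance_matrices_eq)
  then have pos: "card {f \<in> path_arcs (dgraph (R i)) p. colour (R i) f = j} > 0" if "j < K" for j
    using i that by (auto simp: positive_entries_def path_matrix_def)
  \<comment> \<open>Every colour must occur on the path, but its only possible arc is
    \<open>e\<close>; so all colours coincide.\<close>
  have col: "colour (R i) e = j" if "j < K" for j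
    using pos[OF that] only by (metis (mono_tags, lifting) card_eq_0_iff empty_Collect_eq less_irrefl)
  have K1: "K = 1"
  proof (rule ccontr)
    assume "K \<noteq> 1"
    with K_pos have "0 < K" "1 < K" by auto
    from col[OF this(1)] col[OF this(2)] show False by simp
  qed
  with i have "i = 0" by simp
  have "gdist (dgraph (R i)) (beta_plus (R i)) (beta_minus (R i)) \<le> 1"
    using gdist_le_uwalk[OF underlying_simpleD(1)[OF S] uw[of "\<lambda>_. 1"], of 1] by simp
  with assms K1 \<open>i = 0\<close> show False by (simp add: distance_positive_def)
qed

lemma geodesic_weights:
  assumes dp: "distance_positive K R"
  obtains u where "geodesic_eigs K R c0 u (rho_min (distance_matrices K R))"
proof -
  let ?DD = "distance_matrices K R" and ?lam = "rho_min (distance_matrices K R)"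
  have fin: "finite (rho ` ?DD)" using finite_distance_matrices by simp
  have "rho ` ?DD \<noteq> {}" using path_choices_nonempty by (simp add: distance_matrices_eq)
  from Min_in[OF fin this] obtain P where P: "P \<in> path_choices" "rho (path_matrix P) = ?lam"
    by (auto simp: rho_min_def distance_matrices_eq)
  have min: "?lam \<le> rho (path_matrix Q)" if "Q \<in> path_choices" for Q
    unfolding rho_min_def using fin that by (intro Min_le) (auto simp: distance_matrices_eq)
  have pos: "positive_entries (path_matrix Q)" if "Q \<in> path_choices" for Q
    using dp that by (auto simp: distance_positive_def distance_matrices_eq)
  note prim = positive_imp_primitive[OF path_matrix_carrier pos]
  have K: "K > 0" using K_pos by simp
  obtain u where u: "\<And>i. i < K \<Longrightarrow> u i > 0"
    and eig: "\<And>i. i < K \<Longrightarrow> (\<Sum>j<K. real (path_matrix P $$ (i, j)) * u j) = ?lam * u i"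
    using primitive_eigenvector[OF path_matrix_carrier K prim[OF P(1)]] unfolding P(2) by metis
  interpret separated_eigs K R c0 by (rule separated_if_distance_positive[OF dp])
  have "geodesic_eigs K R c0 u ?lam"
  proof
    show "i < K \<Longrightarrow> u i > 0" for i by (rule u)
    show "\<exists>p\<in>simple_paths (dgraph (R i)) (beta_plus (R i)) (beta_minus (R i)).
      (\<Sum>e\<in>path_arcs (dgraph (R i)) p. weight u (R i) e) = ?lam * u i" if "i < K" for i
      using P(1) that path_matrix_row[OF that, of P u] eig[OF that] by (auto simp: path_choices_def)
    show "?lam * u i \<le> (\<Sum>e\<in>path_arcs (dgraph (R i)) p. weight u (R i) e)"
      if i: "i < K" and p: "p \<in> simple_paths (dgraph (R i)) (beta_plus (R i)) (beta_minus (R i))" for i p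
    proof (rule ccontr)
      assume "\<not> ?thesis"
      then have less: "(\<Sum>e\<in>path_arcs (dgraph (R i)) p. weight u (R i) e) < ?lam * u i" by simp
      let ?Q = "P(i := p)"
      note Q = path_choices_upd[OF P(1) p]
      have row: "(\<Sum>j<K. real (path_matrix ?Q $$ (k, j)) * u j) =
        (if k = i then \<Sum>e\<in>path_arcs (dgraph (R i)) p. weight u (R i) e else ?lam * u k)" if "k < K" for k
        using path_matrix_row[OF that, of ?Q u] path_matrix_row[OF that, of P u] eig[OF that] by auto
      have "rho (path_matrix ?Q) < ?lam"
        by (rule rho_less_if_superinvariant[OF path_matrix_carrier K pos[OF Q] u _ i])
          (use row less i in auto)
      with min[OF Q] show False by simp
    qed
    \<comment> \<open>For \<open>K = 1\<close> the factor is the number of arcs on the path, at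
      least 2 by the distance condition. Otherwise row 0 has entries at least 1 and at least two
      columns, so applying it to \<open>u\<close> gives more than \<open>u 0\<close>.\<close>
    show "?lam > 1"
    proof (cases "K = 1")
      case True
      have P0: "P 0 \<in> simple_paths (dgraph (R 0)) (beta_plus (R 0)) (beta_minus (R 0))"
        using P(1) K by (auto simp: path_choices_def)
      from gdist_le_uwalk[OF rule_wf[OF K] simple_path_imp_uwalk[OF rule_simple[OF K] P0, of "\<lambda>_. 1"], of 1]
      have card: "real (card (path_arcs (dgraph (R 0)) (P 0))) \<ge> 2"
        using dp True by (simp add: distance_positive_def)
      have "(\<Sum>e\<in>path_arcs (dgraph (R 0)) (P 0). weight u (R 0) e) =
        (\<Sum>e\<in>path_arcs (dgraph (R 0)) (P 0). u 0)"
        using rule_colour[OF K] True by (intro sum.cong) (auto simp: path_arcs_def weight_def)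
      then have "?lam * u 0 = real (card (path_arcs (dgraph (R 0)) (P 0))) * u 0"
        using eig[OF K] path_matrix_row[OF K, of P u] by (metis sum_constant)
      with card u[OF K] show ?thesis by auto
    next
      case False
      with K have 1: "1 < K" by simp
      have ge1: "real (path_matrix P $$ (0, j)) \<ge> 1" if "j < K" for j
        using pos[OF P(1)] that K path_matrix_carrier[of P] by (auto simp: positive_entries_def Suc_le_eq)
      have "u 0 < (\<Sum>j\<in>{0, 1}. u j)" using u[OF 1] by simp
      also have "\<dots> \<le> (\<Sum>j<K. u j)"
        using 1 u by (intro sum_mono2) (auto intro: less_imp_le)
      also have "\<dots> \<le> (\<Sum>j<K. real (path_matrix P $$ (0, j)) * u j)"
        using ge1 u mult_right_mono[OF ge1 less_imp_le[OF u]] by (intro sum_mono) fastforce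
      finally show ?thesis using eig[OF K] u[OF K] by simp
    qed
  qed
  then show thesis using that by blast
qed

text \<open>Rows \<open>2 * i\<close> and \<open>2 * i + 1\<close> of the eigenvector equation are
  the weighted degrees of the two planting vertices of rule \<open>i\<close>.\<close>

lemma degree_weights:
  assumes "primitive_matrix (degree_matrix K R)"
  obtains y where "\<And>k. k < 2 * K \<Longrightarrow> y k > 0"
    "\<And>i. i < K \<Longrightarrow> degree_sum y (R i) (beta_plus (R i)) = rho (degree_matrix K R) * y (2 * i)"
    "\<And>i. i < K \<Longrightarrow> degree_sum y (R i) (beta_minus (R i)) = rho (degree_matrix K R) * y (2 * i + 1)"
proof -
  have N: "degree_matrix K R \<in> carrier_mat (2 * K) (2 * K)" by (simp add: degree_matrix_def)
  have K: "2 * K > 0" using K_pos by simp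
  obtain y where y: "\<And>k. k < 2 * K \<Longrightarrow> y k > 0"
    and eig: "\<And>k. k < 2 * K \<Longrightarrow> (\<Sum>j<2 * K. real (degree_matrix K R $$ (k, j)) * y j) = rho (degree_matrix K R) * y k"
    using primitive_eigenvector[OF N K assms] by metis
  have ds: "degree_sum y (R i) v = (\<Sum>k<2 * K. real (kappa (R i) v k) * y k)" if "i < K" for i v
    by (rule degree_sum_kappa) (use that rule_colour underlying_simpleD(3)[OF rule_simple] in auto)
  show thesis
  proof (rule that[OF y])
    fix i assume i: "i < K"
    show "degree_sum y (R i) (beta_plus (R i)) = rho (degree_matrix K R) * y (2 * i)"
      using eig[of "2 * i"] i by (simp add: ds degree_matrix_def)
    show "degree_sum y (R i) (beta_minus (R i)) = rho (degree_matrix K R) * y (2 * i + 1)"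
      using eig[of "2 * i + 1"] i by (simp add: ds degree_matrix_def)
  qed
qed

end

theorem proposition2p19:
  fixes K c0 :: nat
    and R :: "nat \<Rightarrow> ('v, 'e) rule_graph"
    and v :: "('v, 'e) iter_vertex"
  assumes "eigs K R c0"
    and "canonical K R"
    and "distance_positive K R"
    and "primitive_matrix (degree_matrix K R)"
    and "v \<in> Xi_verts R c0"
    and "rho (degree_matrix K R) > 1"
  shows "has_local_resistance_dim (\<lambda>n. dgraph (Xi R c0 n)) v
           (- (ln (rho (degree_matrix K R)) / ln (rho_min (distance_matrices K R))))"
proof -
  interpret eigs K R c0 by fact
  obtain u where "geodesic_eigs K R c0 u (rho_min (distance_matrices K R))"
    using geodesic_weights[OF assms(3)] .
  then interpret geodesic_eigs K R c0 u "rho_min (distance_matrices K R)" .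
  obtain y where y: "\<And>k. k < 2 * K \<Longrightarrow> y k > 0"
    "\<And>i. i < K \<Longrightarrow> degree_sum y (R i) (beta_plus (R i)) = rho (degree_matrix K R) * y (2 * i)"
    "\<And>i. i < K \<Longrightarrow> degree_sum y (R i) (beta_minus (R i)) = rho (degree_matrix K R) * y (2 * i + 1)"
    using degree_weights[OF assms(4)] by metis
  show ?thesis
    by (rule has_local_resistance_dim_Xi[OF assms(5) _ y]) (use assms(6) in simp)
qed

end
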